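(* Let $X$ be a path connected, locally path connected, paracompact Hausdorff space with basepoint $x_0$, and give $\pi_1(X,x_0)$ the shape topology. Then the set of Spanier groups $\pi^{Sp}(\mathscr{U},x_0)$, where $\mathscr{U}$ ranges over the open covers of $X$, forms a neighborhood base at the identity of $\pi_1(X,x_0)$.
   Context: Paths are continuous maps from $[0,1]$, $\overline{\alpha}$ is the reverse path, and $[\alpha][\beta]=[\alpha\ast\beta]$ denotes concatenation of homotopy classes rel. endpoints. For an open cover $\mathscr{U}$ of $X$, the Spanier group $\pi^{Sp}(\mathscr{U},x_0)$ is the subgroup of $\pi_1(X,x_0)$ generated by all elements $[\alpha][\gamma][\overline{\alpha}]$ where $\alpha$ is a path with $\alpha(0)=x_0$ and $\gamma$ is a loop based at $\alpha(1)$ with image in some $U\in\mathscr{U}$. First shape group. Consider pairs $(\mathscr{U},U_0)$ with $\mathscr{U}$ an open cover of $X$ and $x_0\in U_0\in\mathscr{U}$. $(\mathscr{V},V_0)$ refines $(\mathscr{U},U_0)$ if $\mathscr{V}$ refines $\mathscr{U}$ and $V_0\subseteq U_0$. The nerve $N(\mathscr{U})$ is the abstract simplicial complex with vertex set $\mathscr{U}$, in which $A_0,\dots,A_n$ span a simplex iff $\bigcap_i A_i\neq\emptyset$; $|N(\mathscr{U})|$ is its geometric realization, based at the vertex $U_0$. Let $\Lambda$ be the set of pairs $(\mathscr{U},U_0)$ admitting a partition of unity $\{\phi_U\}_{U\in\mathscr{U}}$ subordinated to $\mathscr{U}$ with $\phi_{U_0}(x_0)=1$, directed by refinement. If $(\mathscr{V},V_0)$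 refines $(\mathscr{U},U_0)$, any vertex assignment $V\mapsto U$ with $V\subseteq U$ and $V_0\mapsto U_0$ defines a simplicial map $N(\mathscr{V})\to N(\mathscr{U})$ whose realization is unique up to based homotopy; the induced homomorphism is $p_{\mathscr{U}\mathscr{V}\ast}:\pi_1(|N(\mathscr{V})|,V_0)\to\pi_1(|N(\mathscr{U})|,U_0)$. Set $\check{\pi}_1(X,x_0)=\varprojlim(\pi_1(|N(\mathscr{U})|,U_0),p_{\mathscr{U}\mathscr{V}\ast},\Lambda)$. A canonical map for $(\mathscr{U},U_0)$ is a continuous map $p_{\mathscr{U}}:X\to|N(\mathscr{U})|$ with $p_{\mathscr{U}}(x_0)=U_0$ and $p_{\mathscr{U}}^{-1}(St(U,N(\mathscr{U})))\subseteq U$ for all $U\in\mathscr{U}$, where $St(U,N(\mathscr{U}))$ is the open star of the vertex $U$. For $(\mathscr{U},U_0)\in\Lambda$ canonical maps exist and are unique up to based homotopy, and they are compatible with the maps $p_{\mathscr{U}\mathscr{V}\ast}$ on $\pi_1$. Define $\Psi_X:\pi_1(X,x_0)\to\check{\pi}_1(X,x_0)$ by $\Psi_X([\alpha])=([p_{\mathscr{U}}\circ\alpha])_{(\mathscr{U},U_0)\in\Lambda}$. Shape topology. Topologize $\check{\pi}_1(X,x_0)$ as a subspace of the product $\prod_{\Lambda}\pi_1(|N(\mathscr{U})|,U_0)$ of discrete groups. The shape topology on $\pi_1(X,x_0)$ has as open sets exactly the sets $\Psi_X^{-1}(W)$ with $W$ open in $\check{\pi}_1(X,x_0)$; it is a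 group topology. *)

theory Defs
  imports "HOL-Analysis.Analysis" "HOL-Algebra.Generated_Groups" "HOL-Algebra.Product_Groups"
begin

definition open_cover :: "'a topology \<Rightarrow> 'a set set \<Rightarrow> bool" where
  "open_cover X \<U> \<longleftrightarrow> (\<forall>U\<in>\<U>. openin X U) \<and> \<Union>\<U> = topspace X"

definition cover_refines :: "'a set set \<Rightarrow> 'a set set \<Rightarrow> bool" where
  "cover_refines \<V> \<U> \<longleftrightarrow> (\<forall>V\<in>\<V>. \<exists>U\<in>\<U>. V \<subseteq> U)"

definition paracompact_space :: "'a topology \<Rightarrow> bool" where
  "paracompact_space X \<longleftrightarrow>
     (\<forall>\<U>. open_cover X \<U> \<longrightarrow>
        (\<exists>\<V>. open_cover X \<V> \<and> cover_refines \<V> \<U> \<and> locally_finite_in X \<V>))"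

text \<open>The library's \<open>neighbourhood_base_at\<close> only says that \<^emph>\<open>some\<close> members of the family
  form a base; here every member is also required to be a neighbourhood of the point.\<close>

definition is_nhd_base_at :: "'a topology \<Rightarrow> 'a \<Rightarrow> 'a set set \<Rightarrow> bool" where
  "is_nhd_base_at X x \<B> \<longleftrightarrow>
     (\<forall>N\<in>\<B>. N \<subseteq> topspace X \<and> (\<exists>U. openin X U \<and> x \<in> U \<and> U \<subseteq> N)) \<and>
     (\<forall>W. openin X W \<and> x \<in> W \<longrightarrow> (\<exists>N\<in>\<B>. N \<subseteq> W))"

text \<open>The library's \<open>+++\<close>, \<open>reversepath\<close> and \<open>homotopic_paths\<close> live on the topology given by a
  type class; they are restated here for an arbitrary \<open>'a topology\<close>, which is needed for
  the weak topology on the realization of a nerve.\<close>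

definition path_join :: "(real \<Rightarrow> 'a) \<Rightarrow> (real \<Rightarrow> 'a) \<Rightarrow> real \<Rightarrow> 'a" where
  "path_join p q = (\<lambda>t. if t \<le> 1/2 then p (2 * t) else q (2 * t - 1))"

definition path_reverse :: "(real \<Rightarrow> 'a) \<Rightarrow> real \<Rightarrow> 'a" where
  "path_reverse p = (\<lambda>t. p (1 - t))"

definition homotopic_paths_in :: "'a topology \<Rightarrow> (real \<Rightarrow> 'a) \<Rightarrow> (real \<Rightarrow> 'a) \<Rightarrow> bool" where
  "homotopic_paths_in X p q \<longleftrightarrow>
     homotopic_with (\<lambda>r. r 0 = p 0 \<and> r 1 = p 1) (top_of_set {0..1}) X p q"

definition path_class :: "'a topology \<Rightarrow> (real \<Rightarrow> 'a) \<Rightarrow> (real \<Rightarrow> 'a) set" where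
  "path_class X p = {q. homotopic_paths_in X p q}"

definition loop_at :: "'a topology \<Rightarrow> 'a \<Rightarrow> (real \<Rightarrow> 'a) \<Rightarrow> bool" where
  "loop_at X x p \<longleftrightarrow> pathin X p \<and> p 0 = x \<and> p 1 = x"

text \<open>In the multiplication, and in the induced map below, all members of the
  union coincide, because homotopy is compatible with concatenation and composition.\<close>

definition fundamental_group :: "'a topology \<Rightarrow> 'a \<Rightarrow> (real \<Rightarrow> 'a) set monoid" where
  "fundamental_group X x =
     \<lparr>carrier = path_class X ` {p. loop_at X x p},
      monoid.mult = (\<lambda>A B. \<Union>p\<in>A. \<Union>q\<in>B. path_class X (path_join p q)),
      one = path_class X (\<lambda>_. x)\<rparr>"

definition induced_map :: "'b topology \<Rightarrow> ('a \<Rightarrow> 'b) \<Rightarrow> (real \<Rightarrow> 'a) set \<Rightarrow> (real \<Rightarrow> 'b) set" where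
  "induced_map Y f A = (\<Union>p\<in>A. path_class Y (f \<circ> p))"

definition spanier_group :: "'a topology \<Rightarrow> 'a set set \<Rightarrow> 'a \<Rightarrow> (real \<Rightarrow> 'a) set set" where
  "spanier_group X \<U> x0 =
     generate (fundamental_group X x0)
       {path_class X (path_join (path_join \<alpha> \<gamma>) (path_reverse \<alpha>)) | \<alpha> \<gamma>.
          pathin X \<alpha> \<and> \<alpha> 0 = x0 \<and> loop_at X (\<alpha> 1) \<gamma> \<and> (\<exists>U\<in>\<U>. \<gamma> ` {0..1} \<subseteq> U)}"

text \<open>An abstract simplicial complex is given by its set of (nonempty, finite) simplices.
  If the empty set belongs to the cover, it is not a vertex of the nerve.\<close>

definition nerve :: "'a set set \<Rightarrow> 'a set set set" where
  "nerve \<U> = {S. finite S \<and> S \<noteq> {} \<and> S \<subseteq> \<U> \<and> \<Inter>S \<noteq> {}}"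

text \<open>Points of the realization are given by their barycentric coordinates.\<close>

definition realization_set :: "'v set set \<Rightarrow> ('v \<Rightarrow> real) set" where
  "realization_set K = {t. (\<forall>v. 0 \<le> t v) \<and> {v. t v \<noteq> 0} \<in> K \<and> (\<Sum>v | t v \<noteq> 0. t v) = 1}"

definition closed_simplex :: "'v set set \<Rightarrow> 'v set \<Rightarrow> ('v \<Rightarrow> real) set" where
  "closed_simplex K S = {t \<in> realization_set K. {v. t v \<noteq> 0} \<subseteq> S}"

text \<open>The realization carries the weak topology determined by its closed simplices.
  On a closed simplex, whose points vanish outside a fixed finite set of coordinates,
  the product topology of \<open>'v \<Rightarrow> real\<close> induces the Euclidean one.\<close>

definition realization :: "'v set set \<Rightarrow> ('v \<Rightarrow> real) topology" where
  "realization K = topology (\<lambda>W. W \<subseteq> realization_set K \<and>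
     (\<forall>S\<in>K. openin (top_of_set (closed_simplex K S)) (W \<inter> closed_simplex K S)))"

lemma openin_realization:
  "openin (realization K) W \<longleftrightarrow> W \<subseteq> realization_set K \<and>
     (\<forall>S\<in>K. openin (top_of_set (closed_simplex K S)) (W \<inter> closed_simplex K S))"
proof -
  have "istopology (\<lambda>W. W \<subseteq> realization_set K \<and>
     (\<forall>S\<in>K. openin (top_of_set (closed_simplex K S)) (W \<inter> closed_simplex K S)))"
    unfolding istopology_def
  proof (intro conjI allI impI ballI)
    fix A B S
    assume A: "A \<subseteq> realization_set K \<and>
        (\<forall>S\<in>K. openin (top_of_set (closed_simplex K S)) (A \<inter> closed_simplex K S))"
      and B: "B \<subseteq> realization_set K \<and>
        (\<forall>S\<in>K. openin (top_of_set (closed_simplex K S)) (B \<inter> closed_simplex K S))"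
      and S: "S \<in> K"
    have "(A \<inter> B) \<inter> closed_simplex K S = (A \<inter> closed_simplex K S) \<inter> (B \<inter> closed_simplex K S)"
      by blast
    with A B S show "openin (top_of_set (closed_simplex K S)) (A \<inter> B \<inter> closed_simplex K S)"
      by (metis openin_Int)
  next
    fix \<W> S
    assume W: "\<forall>W\<in>\<W>. W \<subseteq> realization_set K \<and>
        (\<forall>S\<in>K. openin (top_of_set (closed_simplex K S)) (W \<inter> closed_simplex K S))"
      and S: "S \<in> K"
    have "\<Union>\<W> \<inter> closed_simplex K S = \<Union>((\<lambda>W. W \<inter> closed_simplex K S) ` \<W>)"
      by blast
    also have "openin (top_of_set (closed_simplex K S)) \<dots>"
      using W S by (intro openin_Union) blast
    finally show "openin (top_of_set (closed_simplex K S)) (\<Union>\<W> \<inter> closed_simplex K S)" .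
  qed auto
  then show ?thesis
    unfolding realization_def by (simp add: topology_inverse')
qed

lemma topspace_realization [simp]: "topspace (realization K) = realization_set K"
proof (rule antisym)
  show "topspace (realization K) \<subseteq> realization_set K"
    using openin_realization by (metis openin_topspace)
  have "openin (realization K) (realization_set K)"
    unfolding openin_realization by (auto simp: closed_simplex_def Int_def)
  then show "realization_set K \<subseteq> topspace (realization K)"
    by (rule openin_subset)
qed

definition vertex :: "'v \<Rightarrow> 'v \<Rightarrow> real" where
  "vertex v = (\<lambda>w. if w = v then 1 else 0)"

definition open_star :: "'v set set \<Rightarrow> 'v \<Rightarrow> ('v \<Rightarrow> real) set" where
  "open_star K v = {t \<in> realization_set K. t v \<noteq> 0}"

definition simplicial_realization :: "('v \<Rightarrow> 'w) \<Rightarrow> ('v \<Rightarrow> real) \<Rightarrow> 'w \<Rightarrow> real" where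
  "simplicial_realization f t = (\<lambda>w. \<Sum>v | t v \<noteq> 0 \<and> f v = w. t v)"

definition subordinate_partition :: "'a topology \<Rightarrow> 'a set set \<Rightarrow> ('a set \<Rightarrow> 'a \<Rightarrow> real) \<Rightarrow> bool" where
  "subordinate_partition X \<U> \<phi> \<longleftrightarrow>
     (\<forall>U\<in>\<U>. continuous_map X euclideanreal (\<phi> U) \<and>
             (\<forall>x\<in>topspace X. 0 \<le> \<phi> U x) \<and>
             X closure_of {x \<in> topspace X. \<phi> U x \<noteq> 0} \<subseteq> U) \<and>
     (\<forall>x\<in>topspace X. \<exists>N. openin X N \<and> x \<in> N \<and> finite {U\<in>\<U>. \<exists>y\<in>N. \<phi> U y \<noteq> 0}) \<and>
     (\<forall>x\<in>topspace X. (\<Sum>U | U \<in> \<U> \<and> \<phi> U x \<noteq> 0. \<phi> U x) = 1)"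

type_synonym 'a pointed_cover = "'a set set \<times> 'a set"

definition shape_index :: "'a topology \<Rightarrow> 'a \<Rightarrow> 'a pointed_cover set" where
  "shape_index X x0 =
     {(\<U>, U0). open_cover X \<U> \<and> U0 \<in> \<U> \<and> x0 \<in> U0 \<and>
                (\<exists>\<phi>. subordinate_partition X \<U> \<phi> \<and> \<phi> U0 x0 = 1)}"

definition pointed_refines :: "'a pointed_cover \<Rightarrow> 'a pointed_cover \<Rightarrow> bool" where
  "pointed_refines v u \<longleftrightarrow> cover_refines (fst v) (fst u) \<and> snd v \<subseteq> snd u"

definition nerve_space :: "'a pointed_cover \<Rightarrow> ('a set \<Rightarrow> real) topology" where
  "nerve_space u = realization (nerve (fst u))"

definition nerve_group :: "'a pointed_cover \<Rightarrow> (real \<Rightarrow> 'a set \<Rightarrow> real) set monoid" where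
  "nerve_group u = fundamental_group (nerve_space u) (vertex (snd u))"

definition vertex_assignment ::
  "'a pointed_cover \<Rightarrow> 'a pointed_cover \<Rightarrow> ('a set \<Rightarrow> 'a set) \<Rightarrow> bool" where
  "vertex_assignment v u f \<longleftrightarrow> (\<forall>V\<in>fst v. f V \<in> fst u \<and> V \<subseteq> f V) \<and> f (snd v) = snd u"

text \<open>\<open>bonding u v\<close> goes from the nerve group of the finer \<open>v\<close> to that of \<open>u\<close>. The choice of
  vertex assignment is immaterial: any two are contiguous, hence induce the same homomorphism.\<close>

definition bonding ::
  "'a pointed_cover \<Rightarrow> 'a pointed_cover \<Rightarrow>
     (real \<Rightarrow> 'a set \<Rightarrow> real) set \<Rightarrow> (real \<Rightarrow> 'a set \<Rightarrow> real) set" where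
  "bonding u v =
     induced_map (nerve_space u) (simplicial_realization (SOME f. vertex_assignment v u f))"

definition shape_group ::
  "'a topology \<Rightarrow> 'a \<Rightarrow> ('a pointed_cover \<Rightarrow> (real \<Rightarrow> 'a set \<Rightarrow> real) set) monoid" where
  "shape_group X x0 = (product_group (shape_index X x0) nerve_group)
     \<lparr>carrier := {g \<in> carrier (product_group (shape_index X x0) nerve_group).
        \<forall>u\<in>shape_index X x0. \<forall>v\<in>shape_index X x0.
          pointed_refines v u \<longrightarrow> bonding u v (g v) = g u}\<rparr>"

definition canonical_map :: "'a topology \<Rightarrow> 'a \<Rightarrow> 'a pointed_cover \<Rightarrow> ('a \<Rightarrow> 'a set \<Rightarrow> real) \<Rightarrow> bool" where
  "canonical_map X x0 u p \<longleftrightarrow>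
     continuous_map X (nerve_space u) p \<and> p x0 = vertex (snd u) \<and>
     (\<forall>U\<in>fst u. {x \<in> topspace X. p x \<in> open_star (nerve (fst u)) U} \<subseteq> U)"

text \<open>Canonical maps exist for every member of the index set and are unique up to based homotopy,
  so the choice below is immaterial.\<close>

definition shape_map ::
  "'a topology \<Rightarrow> 'a \<Rightarrow> (real \<Rightarrow> 'a) set \<Rightarrow> 'a pointed_cover \<Rightarrow> (real \<Rightarrow> 'a set \<Rightarrow> real) set" where
  "shape_map X x0 A =
     (\<lambda>u\<in>shape_index X x0. induced_map (nerve_space u) (SOME p. canonical_map X x0 u p) A)"

definition shape_group_topology ::
  "'a topology \<Rightarrow> 'a \<Rightarrow> ('a pointed_cover \<Rightarrow> (real \<Rightarrow> 'a set \<Rightarrow> real) set) topology" where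
  "shape_group_topology X x0 =
     subtopology
       (product_topology (\<lambda>u. discrete_topology (carrier (nerve_group u))) (shape_index X x0))
       (carrier (shape_group X x0))"

definition shape_topology :: "'a topology \<Rightarrow> 'a \<Rightarrow> (real \<Rightarrow> 'a) set topology" where
  "shape_topology X x0 =
     pullback_topology (carrier (fundamental_group X x0)) (shape_map X x0)
       (shape_group_topology X x0)"

end

theory Submission
  imports Defs
begin

text \<open>A loop in an open star of the nerve is null homotopic. Hence, given finitely many canonical
  maps, the Spanier group of a common refinement of the pulled back open stars lies in
  the kernel of all of them, and every neighbourhood of the identity contains a Spanier group.

  Conversely, an open cover \<open>\<U>\<close> has a refinement \<open>\<V>\<close> in the index set, with path connected members,
  such that the members of \<open>\<V>\<close> containing a given point all lie in one member of \<open>\<U>\<close>. A null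
  homotopy in the nerve of \<open>\<V>\<close> of the image of a loop is cut into small squares, each
  inside an open star. Replacing the nodes by points of the corresponding members of \<open>\<V>\<close> and the edges
  by paths between them gives a grid in \<open>X\<close> whose squares bound loops in members of \<open>\<U>\<close>, so the original
  loop represents an element of the Spanier group of \<open>\<U>\<close>, which therefore contains the
  kernel of a canonical map.\<close>

section \<open>Homotopies of paths in an abstract topology\<close>

text \<open>Two obstacles shape the proof. The nerve may be infinite, and in its weak topology a map
  with continuous coordinates need not be continuous; continuity into it is therefore always reduced
  to finitely many vertices, which is possible along a path, on a single simplex, and locally for a
  partition of unity. In X there is no simplicial structure, so a null homotopy in the nerve is read
  through labels only: the parameter square is subdivided below a Lebesgue number, and what survives
  is which open star contains which piece. Edge paths live in unions of two labels and a square
  involves four labels sharing a point; this is why the refinement has to control all members around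
  a point at once. Base points are handled once and for all: the Spanier group is normal, so
  arbitrary paths, closed up from \<open>x0\<close>, have values in the quotient group, and a square
  whose boundary lies in a member of \<U> becomes a commutation relation. The rest is ordered
  multiplication along the rows of the grid.\<close>

definition path_homotopy :: "'a topology \<Rightarrow> (real \<times> real \<Rightarrow> 'a) \<Rightarrow> (real \<Rightarrow> 'a) \<Rightarrow> (real \<Rightarrow> 'a) \<Rightarrow> bool"
  where "path_homotopy X h p q \<longleftrightarrow>
    continuous_map (top_of_set ({0..1} \<times> {0..1})) X h \<and>
    (\<forall>t\<in>{0..1}. h (0, t) = p t \<and> h (1, t) = q t) \<and>
    (\<forall>s\<in>{0..1}. h (s, 0) = p 0 \<and> h (s, 1) = p 1)"

lemma homotopic_paths_in_iff: "homotopic_paths_in X p q \<longleftrightarrow> (\<exists>h. path_homotopy X h p q)"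
  unfolding homotopic_paths_in_def path_homotopy_def
  by (subst homotopic_with) (auto simp: ball_conj_distrib prod_topology_subtopology_eu intro: arg_cong)

lemma homotopic_paths_in_imp_pathin:
  assumes "homotopic_paths_in X p q"
  shows "pathin X p" "pathin X q"
  using assms homotopic_with_imp_continuous_maps
  unfolding homotopic_paths_in_def pathin_def by blast+

lemma homotopic_paths_in_imp_ends:
  assumes "homotopic_paths_in X p q"
  shows "q 0 = p 0" "q 1 = p 1"
  using homotopic_with_imp_property[OF assms[unfolded homotopic_paths_in_def]] by auto

lemma homotopic_paths_in_refl: "homotopic_paths_in X p p \<longleftrightarrow> pathin X p"
  unfolding homotopic_paths_in_def pathin_def by simp

lemma homotopic_paths_in_sym:
  assumes "homotopic_paths_in X p q"
  shows "homotopic_paths_in X q p"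
  using homotopic_with_symD[OF assms[unfolded homotopic_paths_in_def]]
    homotopic_paths_in_imp_ends[OF assms]
  unfolding homotopic_paths_in_def by simp

lemma homotopic_paths_in_trans [trans]:
  assumes "homotopic_paths_in X p q" "homotopic_paths_in X q r"
  shows "homotopic_paths_in X p r"
  using homotopic_with_trans[OF assms(1)[unfolded homotopic_paths_in_def]
      assms(2)[unfolded homotopic_paths_in_def homotopic_paths_in_imp_ends[OF assms(1)]]]
  unfolding homotopic_paths_in_def .

lemma homotopic_paths_in_compose:
  assumes "homotopic_paths_in X p q" "continuous_map X Y f"
  shows "homotopic_paths_in Y (f \<circ> p) (f \<circ> q)"
  using assms unfolding homotopic_paths_in_def
  by (auto intro: homotopic_with_compose_continuous_map_left)

lemma pathin_reparam:
  assumes "pathin X \<alpha>" "continuous_on {0..1} f" "f ` {0..1} \<subseteq> {0..1}"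
  shows "pathin X (\<alpha> \<circ> f)"
  using assms unfolding pathin_def
  by (intro continuous_map_compose) (auto simp: continuous_map_in_subtopology)

text \<open>The interval is convex, so the segment from \<open>f\<close> to \<open>g\<close> stays
  in it and the homotopy is \<open>\<alpha>\<close> applied to that segment. The unit, inverse and
  associativity laws below are all instances.\<close>

lemma homotopic_paths_in_reparam:
  fixes f g :: "real \<Rightarrow> real"
  assumes \<alpha>: "pathin X \<alpha>"
    and f: "continuous_on {0..1} f" "f ` {0..1} \<subseteq> {0..1}"
    and g: "continuous_on {0..1} g" "g ` {0..1} \<subseteq> {0..1}"
    and ends: "f 0 = g 0" "f 1 = g 1"
  shows "homotopic_paths_in X (\<alpha> \<circ> f) (\<alpha> \<circ> g)"
proof -
  let ?k = "\<lambda>z. (1 - fst z) * f (snd z) + fst z * g (snd z)"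
  have "?k ` ({0..1} \<times> {0..1}) \<subseteq> {0..1}"
  proof clarsimp
    fix s t :: real assume "0 \<le> s" "s \<le> 1" "0 \<le> t" "t \<le> 1"
    moreover from this have "f t \<in> {0..1}" "g t \<in> {0..1}"
      using f g by (auto simp: image_subset_iff)
    ultimately show "0 \<le> (1 - s) * f t + s * g t \<and> (1 - s) * f t + s * g t \<le> 1"
      using convex_bound_le[of "f t" 1 "g t" "1 - s" s] by simp
  qed
  moreover have "continuous_on ({0..1} \<times> {0..1}) ?k"
  proof -
    have "continuous_on ({0..1::real} \<times> {0..1}) (\<lambda>z. f (snd z))"
      "continuous_on ({0..1::real} \<times> {0..1}) (\<lambda>z. g (snd z))"
      using f g by (auto intro!: continuous_on_compose2[of "{0..1}" _ _ snd] continuous_intros)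
    then show ?thesis by (intro continuous_intros)
  qed
  ultimately have "continuous_map (top_of_set ({0..1} \<times> {0..1})) (top_of_set {0..1}) ?k"
    by (auto simp: continuous_map_in_subtopology)
  then have "continuous_map (top_of_set ({0..1} \<times> {0..1})) X (\<alpha> \<circ> ?k)"
    using \<alpha> unfolding pathin_def by (rule continuous_map_compose)
  then show ?thesis
    unfolding homotopic_paths_in_iff path_homotopy_def using ends
    by (intro exI[of _ "\<alpha> \<circ> ?k"]) (auto simp: algebra_simps)
qed

section \<open>Concatenation and reversal\<close>

lemma homotopic_paths_in_join:
  assumes "homotopic_paths_in X p p'" "homotopic_paths_in X q q'" "p 1 = q 0"
  shows "homotopic_paths_in X (path_join p q) (path_join p' q')"
proof -
  let ?S = "{0..1::real} \<times> {0..1::real}"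
  obtain h where h: "path_homotopy X h p p'"
    using assms(1) unfolding homotopic_paths_in_iff by blast
  obtain k where k: "path_homotopy X k q q'"
    using assms(2) unfolding homotopic_paths_in_iff by blast
  note hk = h[unfolded path_homotopy_def] k[unfolded path_homotopy_def]
  let ?f = "\<lambda>z. (fst z, 2 * snd z) :: real \<times> real"
  let ?g = "\<lambda>z. (fst z, 2 * snd z - 1) :: real \<times> real"
  have "continuous_map (subtopology (top_of_set ?S) {z \<in> topspace (top_of_set ?S). snd z \<le> 1/2}) X (h \<circ> ?f)"
    by (rule continuous_map_compose[OF _ conjunct1[OF hk(1)]])
       (auto simp: continuous_map_in_subtopology subtopology_subtopology intro!: continuous_intros)
  moreover have "continuous_map (subtopology (top_of_set ?S) {z \<in> topspace (top_of_set ?S). 1/2 \<le> snd z}) X (k \<circ> ?g)"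
    by (rule continuous_map_compose[OF _ conjunct1[OF hk(2)]])
       (auto simp: continuous_map_in_subtopology subtopology_subtopology intro!: continuous_intros)
  ultimately have "continuous_map (top_of_set ?S) X (\<lambda>z. if snd z \<le> 1/2 then (h \<circ> ?f) z else (k \<circ> ?g) z)"
  proof (rule continuous_map_cases_le[rotated 2])
    fix z assume "z \<in> topspace (top_of_set ?S)" "snd z = 1/2"
    then obtain a where "z = (a, 1/2)" "a \<in> {0..1}"
      by (cases z) auto
    then show "(h \<circ> ?f) z = (k \<circ> ?g) z"
      using hk assms(3) by simp
  qed (auto intro!: continuous_intros)
  then show ?thesis
    unfolding homotopic_paths_in_iff path_homotopy_def path_join_def using hk
    by (intro exI conjI) auto
qed

text \<open>Being a path is the reflexive case of being homotopic, so gluing homotopies already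
  contains gluing paths.\<close>

lemma pathin_join:
  assumes "pathin X p" "pathin X q" "p 1 = q 0"
  shows "pathin X (path_join p q)"
  using homotopic_paths_in_join assms unfolding homotopic_paths_in_refl[symmetric] by metis

lemma path_join_ends [simp]: "path_join p q 0 = p 0" "path_join p q 1 = q 1"
  by (auto simp: path_join_def)

lemma path_reverse_ends [simp]: "path_reverse p 0 = p 1" "path_reverse p 1 = p 0"
  by (auto simp: path_reverse_def)

lemma path_join_image:
  assumes "p ` {0..1} \<subseteq> S" "q ` {0..1} \<subseteq> S"
  shows "path_join p q ` {0..1} \<subseteq> S"
  using assms by (auto simp: path_join_def image_subset_iff)

lemma path_reverse_image: "path_reverse p ` {0..1} = p ` {0..1}"
proof -
  have "(\<lambda>t. 1 - t) ` {0..1::real} = {0..1}"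
    by (auto simp: image_iff intro: bexI[where x = "1 - _"])
  then show ?thesis
    unfolding path_reverse_def by (metis image_image)
qed

lemma pathin_path_reverse: "pathin X p \<Longrightarrow> pathin X (path_reverse p)"
  using pathin_reparam[of X p "\<lambda>t. 1 - t"]
  by (simp add: path_reverse_def o_def continuous_on_op_minus)

lemma path_join_compose: "path_join (f \<circ> p) (f \<circ> q) = f \<circ> path_join p q"
  by (auto simp: path_join_def)

lemma path_reverse_compose: "path_reverse (f \<circ> p) = f \<circ> path_reverse p"
  by (auto simp: path_reverse_def)

lemma path_reverse_path_reverse [simp]: "path_reverse (path_reverse p) = p"
  by (auto simp: path_reverse_def)

section \<open>Groupoid laws up to homotopy\<close>

lemma homotopic_paths_in_rid:
  assumes "pathin X p" "p 1 = x"
  shows "homotopic_paths_in X (path_join p (\<lambda>_. x)) p"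
proof -
  have "path_join p (\<lambda>_. x) = p \<circ> (\<lambda>t. min (2 * t) 1)"
    using assms by (auto simp: path_join_def min_def)
  moreover have "homotopic_paths_in X (p \<circ> (\<lambda>t. min (2 * t) 1)) (p \<circ> (\<lambda>t. t))"
    by (intro homotopic_paths_in_reparam assms) (auto intro!: continuous_intros)
  ultimately show ?thesis by (simp add: o_def)
qed

lemma homotopic_paths_in_lid:
  assumes "pathin X p" "p 0 = x"
  shows "homotopic_paths_in X (path_join (\<lambda>_. x) p) p"
proof -
  have "path_join (\<lambda>_. x) p = p \<circ> (\<lambda>t. max (2 * t - 1) 0)"
    using assms by (auto simp: path_join_def max_def)
  moreover have "homotopic_paths_in X (p \<circ> (\<lambda>t. max (2 * t - 1) 0)) (p \<circ> (\<lambda>t. t))"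
    by (intro homotopic_paths_in_reparam assms) (auto intro!: continuous_intros)
  ultimately show ?thesis by (simp add: o_def)
qed

lemma homotopic_paths_in_rinv:
  assumes "pathin X p" "p 0 = x"
  shows "homotopic_paths_in X (path_join p (path_reverse p)) (\<lambda>_. x)"
proof -
  \<comment> \<open>Going out and back is \<open>p\<close> run along the tent function, which
    vanishes at both ends and so contracts to 0 with its ends fixed.\<close>
  have "path_join p (path_reverse p) = p \<circ> (\<lambda>t. min (2 * t) (2 - 2 * t))"
    using assms by (auto simp: path_join_def path_reverse_def min_def)
  moreover have "homotopic_paths_in X (p \<circ> (\<lambda>t. min (2 * t) (2 - 2 * t))) (p \<circ> (\<lambda>t. 0))"
    by (intro homotopic_paths_in_reparam assms continuous_intros) (auto simp: min_def)
  ultimately show ?thesis using assms by (simp add: o_def)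
qed

lemma homotopic_paths_in_linv:
  assumes "pathin X p" "p 1 = x"
  shows "homotopic_paths_in X (path_join (path_reverse p) p) (\<lambda>_. x)"
  using homotopic_paths_in_rinv[of X "path_reverse p"] assms by (simp add: pathin_path_reverse)

lemma homotopic_paths_in_assoc:
  assumes "pathin X p" "pathin X q" "pathin X r" "p 1 = q 0" "q 1 = r 0"
  shows "homotopic_paths_in X (path_join (path_join p q) r) (path_join p (path_join q r))"
proof -
  define \<phi> :: "real \<Rightarrow> real"
    where "\<phi> t = (if t \<le> 1/4 then 2 * t else if t \<le> 1/2 then t + 1/4 else (t + 1) / 2)" for t
  have "path_join (path_join p q) r t = path_join p (path_join q r) (\<phi> t)" for t
  proof -
    consider "t \<le> 1/4" | "1/4 < t" "t \<le> 1/2" | "1/2 < t" by linarith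
    then show ?thesis
    proof cases
      case 1 then show ?thesis by (simp add: path_join_def \<phi>_def)
    next
      case 2
      then have "2 * (2 * (t + 1/4) - 1) = 2 * (2 * t) - 1" by (simp add: field_simps)
      with 2 show ?thesis by (simp add: path_join_def \<phi>_def)
    next
      case 3
      then have "path_join p (path_join q r) (\<phi> t) = r (2 * (2 * ((t + 1) / 2) - 1) - 1)"
        unfolding path_join_def \<phi>_def by simp
      also have "\<dots> = r (2 * t - 1)" by (rule arg_cong[where f = r]) (simp add: field_simps)
      finally show ?thesis using 3 by (simp add: path_join_def)
    qed
  qed
  then have "path_join (path_join p q) r = path_join p (path_join q r) \<circ> \<phi>"
    by (simp add: fun_eq_iff)
  moreover have "continuous_on {0..1} \<phi>"
  proof -
    \<comment> \<open>The slopes 2, 1, 1/2 decrease, so \<open>\<phi>\<close> is concave and hence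
      the minimum of its three affine pieces; continuity then needs no gluing.\<close>
    have "\<phi> = (\<lambda>t. min (min (2 * t) (t + 1/4)) ((t + 1) / 2))"
      unfolding fun_eq_iff \<phi>_def by (auto simp: min_def)
    then show ?thesis by (auto intro!: continuous_intros)
  qed
  moreover have "homotopic_paths_in X (path_join p (path_join q r) \<circ> \<phi>) (path_join p (path_join q r) \<circ> (\<lambda>t. t))"
    using assms \<open>continuous_on {0..1} \<phi>\<close>
    by (intro homotopic_paths_in_reparam pathin_join) (auto simp: \<phi>_def)
  ultimately show ?thesis by (simp add: o_def)
qed

section \<open>The fundamental group\<close>

text \<open>The class of a function that is not a path is empty, so equal classes carry information
  only if one of them contains its representative.\<close>

lemma path_class_eq:
  assumes "pathin X p"
  shows "path_class X p = path_class X q \<longleftrightarrow> homotopic_paths_in X p q"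
proof
  assume "path_class X p = path_class X q"
  moreover have "p \<in> path_class X p"
    using assms by (simp add: path_class_def homotopic_paths_in_refl)
  ultimately show "homotopic_paths_in X p q"
    by (auto simp: path_class_def intro: homotopic_paths_in_sym)
next
  assume "homotopic_paths_in X p q"
  then show "path_class X p = path_class X q"
    unfolding path_class_def by (blast intro: homotopic_paths_in_sym homotopic_paths_in_trans)
qed

lemma path_class_cong:
  assumes "homotopic_paths_in X p q"
  shows "path_class X p = path_class X q"
  using assms path_class_eq homotopic_paths_in_imp_pathin(1) by metis

lemma path_class_self: "pathin X p \<Longrightarrow> p \<in> path_class X p"
  by (simp add: path_class_def homotopic_paths_in_refl)

lemma fundamental_group_mult:
  assumes "pathin X p" "pathin X q" "p 1 = q 0"
  shows "path_class X p \<otimes>\<^bsub>fundamental_group X x\<^esub> path_class X q = path_class X (path_join p q)"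
proof -
  have *: "path_class X (path_join p' q') = path_class X (path_join p q)"
    if "p' \<in> path_class X p" "q' \<in> path_class X q" for p' q'
  proof -
    have "homotopic_paths_in X p p'" "homotopic_paths_in X q q'"
      using that by (simp_all add: path_class_def)
    then show ?thesis
      using path_class_cong[OF homotopic_paths_in_join] assms(3) by metis
  qed
  have "(\<Union>p'\<in>path_class X p. \<Union>q'\<in>path_class X q. path_class X (path_join p' q')) =
      (\<Union>p'\<in>path_class X p. \<Union>q'\<in>path_class X q. path_class X (path_join p q))"
    by (intro SUP_cong refl *)
  \<comment> \<open>A union of equal sets is that set only over nonempty index sets;
    \<open>p\<close> and \<open>q\<close> themselves witness this.\<close>
  also have "\<dots> = path_class X (path_join p q)"
    using path_class_self[OF assms(1)] path_class_self[OF assms(2)] by auto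
  finally show ?thesis
    by (simp add: fundamental_group_def)
qed

lemma fundamental_group_one: "\<one>\<^bsub>fundamental_group X x\<^esub> = path_class X (\<lambda>_. x)"
  by (simp add: fundamental_group_def)

lemma fundamental_group_carrier:
  "A \<in> carrier (fundamental_group X x) \<longleftrightarrow> (\<exists>p. loop_at X x p \<and> A = path_class X p)"
  by (auto simp: fundamental_group_def)

lemma loop_at_join: "loop_at X x p \<Longrightarrow> loop_at X x q \<Longrightarrow> loop_at X x (path_join p q)"
  by (simp add: loop_at_def pathin_join)

lemma loop_at_reverse: "loop_at X x p \<Longrightarrow> loop_at X x (path_reverse p)"
  by (simp add: loop_at_def pathin_path_reverse)

lemma loop_at_const: "x \<in> topspace X \<Longrightarrow> loop_at X x (\<lambda>_. x)"
  by (simp add: loop_at_def pathin_const)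

lemma path_class_in_carrier: "loop_at X x p \<Longrightarrow> path_class X p \<in> carrier (fundamental_group X x)"
  by (auto simp: fundamental_group_carrier)

lemma group_fundamental_group:
  assumes "x \<in> topspace X"
  shows "group (fundamental_group X x)"
proof (rule groupI)
  show "\<one>\<^bsub>fundamental_group X x\<^esub> \<in> carrier (fundamental_group X x)"
    using assms by (auto simp: fundamental_group_one intro: path_class_in_carrier loop_at_const)
next
  fix A B assume "A \<in> carrier (fundamental_group X x)" "B \<in> carrier (fundamental_group X x)"
  then obtain p q where "loop_at X x p" "A = path_class X p" "loop_at X x q" "B = path_class X q"
    unfolding fundamental_group_carrier by blast
  then show "A \<otimes>\<^bsub>fundamental_group X x\<^esub> B \<in> carrier (fundamental_group X x)"
    using loop_at_join[of X x p q] by (auto simp: loop_at_def fundamental_group_mult fundamental_group_carrier)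
next
  fix A B C assume "A \<in> carrier (fundamental_group X x)" "B \<in> carrier (fundamental_group X x)"
    "C \<in> carrier (fundamental_group X x)"
  then obtain p q r where "loop_at X x p" "A = path_class X p" "loop_at X x q" "B = path_class X q"
    "loop_at X x r" "C = path_class X r"
    unfolding fundamental_group_carrier by blast
  then show "A \<otimes>\<^bsub>fundamental_group X x\<^esub> B \<otimes>\<^bsub>fundamental_group X x\<^esub> C =
    A \<otimes>\<^bsub>fundamental_group X x\<^esub> (B \<otimes>\<^bsub>fundamental_group X x\<^esub> C)"
    by (auto simp: loop_at_def fundamental_group_mult pathin_join
        intro!: path_class_cong homotopic_paths_in_assoc)
next
  fix A assume "A \<in> carrier (fundamental_group X x)"
  then obtain p where p: "loop_at X x p" "A = path_class X p"
    unfolding fundamental_group_carrier by blast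
  then show "\<one>\<^bsub>fundamental_group X x\<^esub> \<otimes>\<^bsub>fundamental_group X x\<^esub> A = A"
    using loop_at_const[OF assms]
    by (auto simp: loop_at_def fundamental_group_mult fundamental_group_one
        intro!: path_class_cong homotopic_paths_in_lid)
  show "\<exists>B\<in>carrier (fundamental_group X x). B \<otimes>\<^bsub>fundamental_group X x\<^esub> A = \<one>\<^bsub>fundamental_group X x\<^esub>"
  proof
    show "path_class X (path_reverse p) \<in> carrier (fundamental_group X x)"
      using p by (intro path_class_in_carrier loop_at_reverse)
    show "path_class X (path_reverse p) \<otimes>\<^bsub>fundamental_group X x\<^esub> A = \<one>\<^bsub>fundamental_group X x\<^esub>"
      using p by (auto simp: loop_at_def fundamental_group_mult fundamental_group_one pathin_path_reverse
          intro!: path_class_cong homotopic_paths_in_linv)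
  qed
qed

lemma fundamental_group_inv:
  assumes "loop_at X x p"
  shows "inv\<^bsub>fundamental_group X x\<^esub> (path_class X p) = path_class X (path_reverse p)"
proof -
  have "x \<in> topspace X"
    using assms path_start_in_topspace unfolding loop_at_def by metis
  then interpret group "fundamental_group X x" by (rule group_fundamental_group)
  show ?thesis
    using assms
    by (intro inv_equality)
       (auto simp: loop_at_def fundamental_group_mult fundamental_group_one pathin_path_reverse
         intro!: path_class_cong homotopic_paths_in_linv path_class_in_carrier loop_at_reverse)
qed

section \<open>Induced homomorphisms\<close>

lemma induced_map_path_class:
  assumes "continuous_map X Y f" "pathin X p"
  shows "induced_map Y f (path_class X p) = path_class Y (f \<circ> p)"
proof -
  have *: "path_class Y (f \<circ> q) = path_class Y (f \<circ> p)" if "q \<in> path_class X p" for q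
    using path_class_cong[OF homotopic_paths_in_compose[OF _ assms(1)], of p q] that
    by (simp add: path_class_def)
  have "(\<Union>q\<in>path_class X p. path_class Y (f \<circ> q)) = (\<Union>q\<in>path_class X p. path_class Y (f \<circ> p))"
    by (intro SUP_cong refl *)
  then show ?thesis
    using path_class_self[OF assms(2)] unfolding induced_map_def by auto
qed

lemma loop_at_compose:
  assumes "continuous_map X Y f" "loop_at X x p"
  shows "loop_at Y (f x) (f \<circ> p)"
  using assms pathin_compose unfolding loop_at_def by fastforce

lemma induced_map_hom:
  assumes "continuous_map X Y f"
  shows "induced_map Y f \<in> hom (fundamental_group X x) (fundamental_group Y (f x))"
proof (rule homI)
  fix A assume "A \<in> carrier (fundamental_group X x)"
  then obtain p where "loop_at X x p" "A = path_class X p"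
    unfolding fundamental_group_carrier by blast
  then show "induced_map Y f A \<in> carrier (fundamental_group Y (f x))"
    using loop_at_compose[OF assms] induced_map_path_class[OF assms]
    unfolding fundamental_group_carrier loop_at_def by metis
next
  fix A B assume "A \<in> carrier (fundamental_group X x)" "B \<in> carrier (fundamental_group X x)"
  then obtain p q where pq: "loop_at X x p" "A = path_class X p" "loop_at X x q" "B = path_class X q"
    unfolding fundamental_group_carrier by blast
  then have "A \<otimes>\<^bsub>fundamental_group X x\<^esub> B = path_class X (path_join p q)"
    by (simp add: loop_at_def fundamental_group_mult)
  moreover have "path_class Y (f \<circ> p) \<otimes>\<^bsub>fundamental_group Y (f x)\<^esub> path_class Y (f \<circ> q) =
      path_class Y (path_join (f \<circ> p) (f \<circ> q))"
    using pq loop_at_compose[OF assms] by (intro fundamental_group_mult) (auto simp: loop_at_def)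
  ultimately show "induced_map Y f (A \<otimes>\<^bsub>fundamental_group X x\<^esub> B) =
    induced_map Y f A \<otimes>\<^bsub>fundamental_group Y (f x)\<^esub> induced_map Y f B"
    using pq loop_at_join[OF pq(1,3)] assms
    by (simp add: loop_at_def induced_map_path_class path_join_compose)
qed

section \<open>Geometric realizations\<close>

text \<open>A sum over an infinite set is 0 by convention, so the total 1 forces a finite
  support.\<close>

lemma realization_set_finite: "t \<in> realization_set K \<Longrightarrow> finite {v. t v \<noteq> 0}"
  unfolding realization_set_def using sum.infinite by fastforce

lemma sum_eq_sum_support:
  fixes t :: "'v \<Rightarrow> real"
  assumes "finite F" "{v. t v \<noteq> 0} \<subseteq> F"
  shows "(\<Sum>v | t v \<noteq> 0. t v) = (\<Sum>v\<in>F. t v)"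
  using assms by (intro sum.mono_neutral_left) auto

lemma vertex_in_realization_set: "{v} \<in> K \<Longrightarrow> vertex v \<in> realization_set K"
  by (simp add: realization_set_def vertex_def)

lemma continuous_map_realization_coordinate:
  "continuous_map (realization K) euclideanreal (\<lambda>t. t v)"
proof (clarsimp simp: continuous_map_def openin_realization)
  fix U :: "real set" and S assume "open U" "S \<in> K"
  have "{t \<in> realization_set K. t v \<in> U} \<inter> closed_simplex K S = closed_simplex K S \<inter> (\<lambda>t. t v) -` U"
    by (auto simp: closed_simplex_def)
  moreover have "open ((\<lambda>t. t v) -` U)"
    by (rule open_vimage[OF \<open>open U\<close> continuous_on_product_coordinates])
  ultimately show "openin (top_of_set (closed_simplex K S)) ({t \<in> realization_set K. t v \<in> U} \<inter> closed_simplex K S)"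
    by (simp add: openin_open_Int)
qed

lemma openin_open_star: "openin (realization K) (open_star K v)"
proof -
  have "openin (realization K) {t \<in> topspace (realization K). t v \<in> - {0}}"
    by (rule openin_continuous_map_preimage[OF continuous_map_realization_coordinate]) auto
  then show ?thesis by (simp add: open_star_def)
qed

lemma closed_coordinate_zero: "closed {t :: 'v \<Rightarrow> real. t v = 0}"
  by (intro closed_Collect_eq continuous_on_product_coordinates continuous_on_const)

text \<open>Finitely many vertices span finitely many closed simplices, each closed in the product
  topology, so there the weak topology is no finer than the product topology. The argument passes to
  complements because it is a finite union of closed sets that is under control: openness in each
  simplex does not directly give openness in their union.\<close>

lemma openin_realization_finite_vertices:
  assumes "finite F" "openin (realization K) W"
  defines "R \<equiv> {t \<in> realization_set K. {v. t v \<noteq> 0} \<subseteq> F}"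
  shows "openin (top_of_set R) (W \<inter> R)"
proof -
  let ?C = "{S \<in> K. S \<subseteq> F}"
  have "finite ?C"
    using finite_subset[of ?C "Pow F"] assms(1) by auto
  have "closedin (top_of_set R) (closed_simplex K S - W)" if "S \<in> ?C" for S
  proof (rule closedin_trans)
    have "openin (top_of_set (closed_simplex K S)) (W \<inter> closed_simplex K S)"
      using assms(2) that by (simp add: openin_realization)
    then have "closedin (top_of_set (closed_simplex K S)) (closed_simplex K S - W \<inter> closed_simplex K S)"
      using closedin_diff closedin_topspace by fastforce
    then show "closedin (top_of_set (closed_simplex K S)) (closed_simplex K S - W)"
      by (simp add: Diff_Int)
    have "closed_simplex K S = R \<inter> (\<Inter>v\<in>-S. {t. t v = 0})"
      using that by (auto simp: closed_simplex_def R_def)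
    moreover have "closed (\<Inter>v\<in>-S. {t :: 'a \<Rightarrow> real. t v = 0})"
      by (intro closed_INT ballI closed_coordinate_zero)
    ultimately show "closedin (top_of_set R) (closed_simplex K S)"
      by (simp add: closedin_closed_Int)
  qed
  then have "closedin (top_of_set R) (\<Union>S\<in>?C. closed_simplex K S - W)"
    using \<open>finite ?C\<close> by (intro closedin_Union) auto
  then have "openin (top_of_set R) (R - (\<Union>S\<in>?C. closed_simplex K S - W))"
    by (intro openin_diff) auto
  moreover have "R - (\<Union>S\<in>?C. closed_simplex K S - W) = W \<inter> R"
    by (auto simp: R_def closed_simplex_def realization_set_def)
  ultimately show ?thesis
    by simp
qed

text \<open>Every continuity proof into a realization below reduces to this one: once the values use
  a fixed finite vertex set, the coordinates decide.\<close>

lemma continuous_map_into_realization: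
  assumes "finite F"
    and f: "\<And>x. x \<in> topspace Y \<Longrightarrow> f x \<in> realization_set K"
      "\<And>x. x \<in> topspace Y \<Longrightarrow> {v. f x v \<noteq> 0} \<subseteq> F"
    and cont: "\<And>v. v \<in> F \<Longrightarrow> continuous_map Y euclideanreal (\<lambda>x. f x v)"
  shows "continuous_map Y (realization K) f"
proof -
  define R where "R = {t \<in> realization_set K. {v. t v \<noteq> 0} \<subseteq> F}"
  have "continuous_map Y euclideanreal (\<lambda>x. f x v)" for v
  proof (cases "v \<in> F")
    case False
    then have "f x v = 0" if "x \<in> topspace Y" for x
      using f(2)[OF that] by auto
    then show ?thesis
      using continuous_map_eq[of Y euclideanreal "\<lambda>_. 0" "\<lambda>x. f x v"] by simp
  qed (rule cont)
  then have "continuous_map Y euclidean f"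
    by (subst euclidean_product_topology[symmetric], subst continuous_map_componentwise_UNIV) blast
  then have R: "continuous_map Y (top_of_set R) f"
    using f by (auto simp: continuous_map_in_subtopology R_def)
  have "openin Y {x \<in> topspace Y. f x \<in> W}" if "openin (realization K) W" for W
  proof -
    have "openin Y {x \<in> topspace Y. f x \<in> W \<inter> R}"
      using openin_realization_finite_vertices[OF assms(1) that]
      by (intro openin_continuous_map_preimage[OF R]) (simp add: R_def)
    moreover have "{x \<in> topspace Y. f x \<in> W \<inter> R} = {x \<in> topspace Y. f x \<in> W}"
      using f by (auto simp: R_def)
    ultimately show ?thesis by simp
  qed
  then show ?thesis
    unfolding continuous_map_def using f(1) by (intro conjI allI impI) auto
qed

text \<open>If the path met infinitely many open simplices, a choice of one point in each would be an
  infinite subset of the compact image without a limit point, because each closed simplex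
  contains only finitely many of these points.\<close>

lemma path_realization_finite_vertices:
  assumes K: "\<And>S. S \<in> K \<Longrightarrow> finite S" and p: "pathin (realization K) p"
  shows "finite (\<Union>r\<in>{0..1}. {v. p r v \<noteq> 0})"
proof -
  define supp where "supp t = {v. t v \<noteq> 0}" for t :: "'a \<Rightarrow> real"
  define C where "C = p ` {0..1}"
  have C: "compactin (realization K) C"
    unfolding C_def using p by (rule compactin_path_image)
  then have CR: "C \<subseteq> realization_set K"
    using compactin_subset_topspace by fastforce
  have "finite (supp ` C)"
  proof (rule ccontr)
    assume "infinite (supp ` C)"
    define D where "D = inv_into C supp ` (supp ` C)"
    have DC: "D \<subseteq> C"
      unfolding D_def by (auto intro: inv_into_into)
    have "inj_on supp D"
    proof (rule inj_on_inverseI)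
      fix d assume "d \<in> D"
      then obtain S where "S \<in> supp ` C" "d = inv_into C supp S"
        unfolding D_def by blast
      then show "inv_into C supp (supp d) = d"
        by (simp add: f_inv_into_f)
    qed
    have "infinite D"
      unfolding D_def using \<open>infinite (supp ` C)\<close>
      by (metis finite_imageD inj_on_inv_into order_refl)
    then obtain x where x: "x \<in> (realization K) derived_set_of D"
      using compactin_imp_Bolzano_Weierstrass[OF C] DC by blast
    \<comment> \<open>Deleting the chosen points other than \<open>x\<close> leaves a set that meets
      \<open>D\<close> at most in \<open>x\<close>; if it is open, \<open>x\<close> cannot be a
      limit point of \<open>D\<close>.\<close>
    define W where "W = realization_set K - (D - {x})"
    have "openin (realization K) W"
      unfolding openin_realization
    proof (intro conjI ballI)
      fix S assume "S \<in> K"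
      let ?E = "(D - {x}) \<inter> closed_simplex K S"
      have "supp ` ?E \<subseteq> Pow S"
        by (auto simp: closed_simplex_def supp_def)
      then have "finite (supp ` ?E)"
        using K[OF \<open>S \<in> K\<close>] finite_subset by blast
      moreover have "inj_on supp ?E"
        using \<open>inj_on supp D\<close> by (rule inj_on_subset) auto
      ultimately have "finite ?E"
        by (rule finite_imageD)
      moreover have "closed {t}" for t :: "'a \<Rightarrow> real"
      proof -
        have "{t} = (\<Inter>v. {s. s v = t v})" by auto
        moreover have "closed \<dots>"
          by (intro closed_INT ballI closed_Collect_eq continuous_on_product_coordinates continuous_on_const)
        ultimately show ?thesis by simp
      qed
      ultimately have "closed ?E"
        using closed_UN[of ?E "\<lambda>t. {t}"] by simp
      moreover have "W \<inter> closed_simplex K S = closed_simplex K S \<inter> - ?E"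
        unfolding W_def by (auto simp: closed_simplex_def)
      ultimately show "openin (top_of_set (closed_simplex K S)) (W \<inter> closed_simplex K S)"
        by (metis open_Compl openin_open_Int)
    qed (auto simp: W_def)
    moreover have "x \<in> W"
      using x by (auto simp: W_def in_derived_set_of)
    ultimately obtain y where "y \<noteq> x" "y \<in> D" "y \<in> W"
      using x unfolding in_derived_set_of by blast
    then show False by (simp add: W_def)
  qed
  moreover have "finite S" if "S \<in> supp ` C" for S
    using that CR realization_set_finite unfolding supp_def by blast
  ultimately have "finite (\<Union>(supp ` C))"
    by (rule finite_Union)
  then show ?thesis
    by (simp add: C_def supp_def image_image)
qed

text \<open>Nonnegative coordinates cannot cancel, so strictly between the ends the support is the
  union of the two supports, which is a simplex by assumption. At the ends the support may be
  smaller, hence the separate cases.\<close>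

lemma convex_combination_realization:
  fixes a b :: "'v \<Rightarrow> real"
  assumes a: "a \<in> realization_set K" and b: "b \<in> realization_set K"
    and ab: "{v. a v \<noteq> 0} \<union> {v. b v \<noteq> 0} \<in> K" and s: "0 \<le> s" "s \<le> 1"
  shows "(\<lambda>v. (1 - s) * a v + s * b v) \<in> realization_set K"
proof -
  let ?c = "\<lambda>v. (1 - s) * a v + s * b v"
  let ?F = "{v. a v \<noteq> 0} \<union> {v. b v \<noteq> 0}"
  have nonneg: "0 \<le> a v" "0 \<le> b v" for v
    using a b by (auto simp: realization_set_def)
  have "finite ?F"
    using a b realization_set_finite by blast
  consider "s = 0" | "s = 1" | "0 < s" "s < 1" using s by linarith
  then show ?thesis
  proof cases
    case 3
    have "?c v = 0 \<longleftrightarrow> a v = 0 \<and> b v = 0" for v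
      using nonneg[of v] 3 by (subst add_nonneg_eq_0_iff) auto
    then have supp: "{v. ?c v \<noteq> 0} = ?F" by auto
    have "(\<Sum>v | ?c v \<noteq> 0. ?c v) = (1 - s) * (\<Sum>v\<in>?F. a v) + s * (\<Sum>v\<in>?F. b v)"
      unfolding supp by (simp add: sum.distrib sum_distrib_left)
    also have "\<dots> = 1"
      using a b sum_eq_sum_support[OF \<open>finite ?F\<close>, of a] sum_eq_sum_support[OF \<open>finite ?F\<close>, of b]
      by (simp add: realization_set_def)
    finally show ?thesis
      using ab s nonneg unfolding realization_set_def by (simp add: supp)
  qed (use a b in simp_all)
qed

text \<open>Straight-line homotopies need not be continuous for the weak topology on an infinite complex,
  but two paths run in a finite subcomplex.\<close>

lemma homotopic_paths_in_realization:
  assumes K: "\<And>S. S \<in> K \<Longrightarrow> finite S"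
    and p: "pathin (realization K) p" and q: "pathin (realization K) q"
    and pq: "\<And>r. r \<in> {0..1} \<Longrightarrow> {v. p r v \<noteq> 0} \<union> {v. q r v \<noteq> 0} \<in> K"
    and ends: "p 0 = q 0" "p 1 = q 1"
  shows "homotopic_paths_in (realization K) p q"
proof -
  define F where "F = (\<Union>r\<in>{0..1}. {v. p r v \<noteq> 0}) \<union> (\<Union>r\<in>{0..1}. {v. q r v \<noteq> 0})"
  let ?h = "\<lambda>z v. (1 - fst z) * p (snd z) v + fst z * q (snd z) v"
  have "p r \<in> realization_set K" "q r \<in> realization_set K" if "r \<in> {0..1}" for r
    using that path_image_subset_topspace[OF p] path_image_subset_topspace[OF q]
    by (auto simp: image_subset_iff Pi_iff)
  note in_real = this
  have "continuous_map (top_of_set ({0..1} \<times> {0..1})) (realization K) ?h"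
  proof (rule continuous_map_into_realization)
    show "finite F"
      unfolding F_def
      using path_realization_finite_vertices[OF K p] path_realization_finite_vertices[OF K q] by simp
    show "?h z \<in> realization_set K" if "z \<in> topspace (top_of_set ({0..1} \<times> {0..1}))" for z
      using that in_real pq by (intro convex_combination_realization) auto
    show "{v. ?h z v \<noteq> 0} \<subseteq> F" if "z \<in> topspace (top_of_set ({0..1} \<times> {0..1}))" for z
    proof
      fix v assume "v \<in> {v. ?h z v \<noteq> 0}"
      then have "p (snd z) v \<noteq> 0 \<or> q (snd z) v \<noteq> 0" by auto
      moreover have "snd z \<in> {0..1}" using that by auto
      ultimately show "v \<in> F" unfolding F_def by blast
    qed
    show "continuous_map (top_of_set ({0..1} \<times> {0..1})) euclideanreal (\<lambda>z. ?h z v)" for v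
    proof -
      have "continuous_map (top_of_set {0..1}) euclideanreal ((\<lambda>t. t v) \<circ> p)"
        "continuous_map (top_of_set {0..1}) euclideanreal ((\<lambda>t. t v) \<circ> q)"
        by (rule continuous_map_compose[OF p[unfolded pathin_def] continuous_map_realization_coordinate]
            continuous_map_compose[OF q[unfolded pathin_def] continuous_map_realization_coordinate])+
      then have "continuous_on {0..1} (\<lambda>r. p r v)" "continuous_on {0..1} (\<lambda>r. q r v)"
        by (simp_all add: o_def)
      then have "continuous_on ({0..1::real} \<times> {0..1}) (\<lambda>z. p (snd z) v)"
        "continuous_on ({0..1::real} \<times> {0..1}) (\<lambda>z. q (snd z) v)"
        by (auto intro!: continuous_on_compose2[of "{0..1}" _ _ snd] continuous_intros)
      then show ?thesis
        by (simp add: continuous_intros)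
    qed
  qed
  then show ?thesis
    unfolding homotopic_paths_in_iff path_homotopy_def using ends
    by (intro exI[of _ ?h]) (simp add: algebra_simps)
qed

text \<open>Coordinates are nonnegative, so the sum over a fibre of \<open>f\<close> vanishes only
  if every term does.\<close>

lemma simplicial_realization_support:
  assumes "t \<in> realization_set K"
  shows "{w. simplicial_realization f t w \<noteq> 0} = f ` {v. t v \<noteq> 0}"
proof -
  have nonneg: "0 \<le> t v" for v
    using assms by (auto simp: realization_set_def)
  have "simplicial_realization f t w = 0 \<longleftrightarrow> (\<forall>v. t v \<noteq> 0 \<longrightarrow> f v \<noteq> w)" for w
    unfolding simplicial_realization_def
    using nonneg realization_set_finite[OF assms] by (subst sum_nonneg_eq_0_iff) auto
  then show ?thesis by auto
qed

lemma simplicial_realization_in_realization_set: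
  assumes t: "t \<in> realization_set K" and f: "\<And>S. S \<in> K \<Longrightarrow> f ` S \<in> L"
  shows "simplicial_realization f t \<in> realization_set L"
proof -
  \<comment> \<open>Regrouping the coordinates along the fibres of \<open>f\<close> preserves the
    total mass 1.\<close>
  have "(\<Sum>w\<in>f ` {v. t v \<noteq> 0}. simplicial_realization f t w) = (\<Sum>v | t v \<noteq> 0. t v)"
    unfolding simplicial_realization_def
    using sum.image_gen[OF realization_set_finite[OF t], of t f] by simp
  then show ?thesis
    using t f simplicial_realization_support[OF t, of f]
    unfolding realization_set_def
    by (auto simp: simplicial_realization_def intro!: sum_nonneg)
qed

lemma continuous_map_simplicial_realization:
  assumes K: "\<And>S. S \<in> K \<Longrightarrow> finite S" and f: "\<And>S. S \<in> K \<Longrightarrow> f ` S \<in> L"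
  shows "continuous_map (realization K) (realization L) (simplicial_realization f)"
proof -
  let ?f = "simplicial_realization f"
  have simplex: "continuous_map (top_of_set (closed_simplex K S)) (realization L) ?f" if "S \<in> K" for S
  proof (rule continuous_map_into_realization)
    show "finite (f ` S)" using K that by blast
    show "?f t \<in> realization_set L" if "t \<in> topspace (top_of_set (closed_simplex K S))" for t
      using that f by (intro simplicial_realization_in_realization_set) (auto simp: closed_simplex_def)
    show "{w. ?f t w \<noteq> 0} \<subseteq> f ` S" if "t \<in> topspace (top_of_set (closed_simplex K S))" for t
      using that by (subst simplicial_realization_support[of t K]) (auto simp: closed_simplex_def)
    fix w
    \<comment> \<open>The sum over the support, which varies with \<open>t\<close>, is replaced by
      one over a fixed set; the added terms are 0.\<close>
    have "?f t w = (\<Sum>v | v \<in> S \<and> f v = w. t v)" if "t \<in> closed_simplex K S" for t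
      unfolding simplicial_realization_def using K[OF \<open>S \<in> K\<close>] that
      by (intro sum.mono_neutral_left) (auto simp: closed_simplex_def)
    moreover have "continuous_on (closed_simplex K S) (\<lambda>t. \<Sum>v | v \<in> S \<and> f v = w. t v)"
      by (intro continuous_on_sum continuous_on_subset[OF continuous_on_product_coordinates]) auto
    ultimately show "continuous_map (top_of_set (closed_simplex K S)) euclideanreal (\<lambda>t. ?f t w)"
      by (simp cong: continuous_on_cong)
  qed
  have "openin (realization K) {t \<in> topspace (realization K). ?f t \<in> W}" if "openin (realization L) W" for W
    unfolding openin_realization
  proof (intro conjI ballI)
    fix S assume "S \<in> K"
    have "{t \<in> topspace (realization K). ?f t \<in> W} \<inter> closed_simplex K S =
        {t \<in> topspace (top_of_set (closed_simplex K S)). ?f t \<in> W}"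
      by (auto simp: closed_simplex_def)
    then show "openin (top_of_set (closed_simplex K S))
        ({t \<in> topspace (realization K). ?f t \<in> W} \<inter> closed_simplex K S)"
      using openin_continuous_map_preimage[OF simplex[OF \<open>S \<in> K\<close>] that] by simp
  qed auto
  then show ?thesis
    using simplicial_realization_in_realization_set[OF _ f] by (auto simp: continuous_map_def)
qed

section \<open>Open covers of paracompact Hausdorff spaces\<close>

lemma continuous_map_locally:
  assumes "\<And>x. x \<in> topspace X \<Longrightarrow> \<exists>N. openin X N \<and> x \<in> N \<and> continuous_map (subtopology X N) Y f"
  shows "continuous_map X Y f"
  unfolding continuous_map_def
proof (intro conjI allI impI)
  show "f \<in> topspace X \<rightarrow> topspace Y"
  proof
    fix x assume "x \<in> topspace X"
    then obtain N where "openin X N" "x \<in> N" "continuous_map (subtopology X N) Y f"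
      using assms by blast
    then show "f x \<in> topspace Y"
      using \<open>x \<in> topspace X\<close> unfolding continuous_map_def by auto
  qed
  fix W assume W: "openin Y W"
  show "openin X {x \<in> topspace X. f x \<in> W}"
  proof (subst openin_subopen, intro ballI)
    fix x assume x: "x \<in> {x \<in> topspace X. f x \<in> W}"
    then obtain N where N: "openin X N" "x \<in> N" "continuous_map (subtopology X N) Y f"
      using assms by blast
    have "openin (subtopology X N) {y \<in> topspace (subtopology X N). f y \<in> W}"
      by (rule openin_continuous_map_preimage[OF N(3) W])
    then have "openin X {y \<in> topspace (subtopology X N). f y \<in> W}"
      using N(1) openin_trans_full by blast
    with N x show "\<exists>T. openin X T \<and> x \<in> T \<and> T \<subseteq> {x \<in> topspace X. f x \<in> W}"
      by (intro exI[of _ "{y \<in> topspace (subtopology X N). f y \<in> W}"]) auto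
  qed
qed

text \<open>With \<open>D\<close> a point this upgrades Hausdorff to regular, with \<open>D\<close>
  a closed set it upgrades regular to normal. Local finiteness is what lets closures commute with
  the union of the pieces covering \<open>C\<close>.\<close>

lemma paracompact_separation:
  assumes "paracompact_space X" "closedin X C"
    and sep: "\<And>c. c \<in> C \<Longrightarrow> \<exists>W. openin X W \<and> c \<in> W \<and> disjnt D (X closure_of W)"
  shows "\<exists>G. openin X G \<and> C \<subseteq> G \<and> disjnt D (X closure_of G)"
proof -
  define \<U> where "\<U> = insert (topspace X - C) {W. openin X W \<and> disjnt D (X closure_of W)}"
  have "open_cover X \<U>"
    unfolding open_cover_def
  proof
    show "\<forall>U\<in>\<U>. openin X U"
      using assms(2) by (auto simp: \<U>_def)
    then have "\<Union>\<U> \<subseteq> topspace X"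
      using openin_subset by blast
    moreover have "x \<in> \<Union>\<U>" if "x \<in> topspace X" for x
      using sep[of x] that unfolding \<U>_def by blast
    ultimately show "\<Union>\<U> = topspace X" by blast
  qed
  then obtain \<V> where \<V>: "open_cover X \<V>" "cover_refines \<V> \<U>" "locally_finite_in X \<V>"
    using assms(1) unfolding paracompact_space_def by blast
  \<comment> \<open>A member of the refinement that meets \<open>C\<close> cannot lie in the
    complement of \<open>C\<close>, so it lies in an open set whose closure misses
    \<open>D\<close>.\<close>
  define \<W> where "\<W> = {V \<in> \<V>. V \<inter> C \<noteq> {}}"
  have "locally_finite_in X \<W>"
    using \<V>(3) by (rule locally_finite_in_subset) (auto simp: \<W>_def)
  have "disjnt D (X closure_of W)" if "W \<in> \<W>" for W
  proof -
    have "W \<in> \<V>" using that by (simp add: \<W>_def)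
    then obtain U where "U \<in> \<U>" "W \<subseteq> U"
      using \<V>(2) unfolding cover_refines_def by meson
    then have "disjnt D (X closure_of U)"
      using that unfolding \<W>_def \<U>_def by blast
    then show ?thesis
      using closure_of_mono[OF \<open>W \<subseteq> U\<close>] disjnt_subset2 by blast
  qed
  then have "disjnt D (X closure_of \<Union>\<W>)"
    by (auto simp: closure_of_locally_finite_Union[OF \<open>locally_finite_in X \<W>\<close>] disjnt_def)
  moreover have "openin X (\<Union>\<W>)"
    using \<V>(1) by (intro openin_Union) (auto simp: \<W>_def open_cover_def)
  moreover have "C \<subseteq> \<Union>\<W>"
    using \<V>(1) closedin_subset[OF assms(2)] unfolding \<W>_def open_cover_def by blast
  ultimately show ?thesis by blast
qed

lemma paracompact_Hausdorff_imp_regular_space: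
  assumes "paracompact_space X" "Hausdorff_space X"
  shows "regular_space X"
  unfolding regular_space_def
proof (intro allI impI)
  fix C a assume C: "closedin X C \<and> a \<in> topspace X - C"
  have "\<exists>W. openin X W \<and> c \<in> W \<and> disjnt {a} (X closure_of W)" if "c \<in> C" for c
  proof -
    have "c \<in> topspace X" "c \<noteq> a"
      using C that closedin_subset by blast+
    then obtain U V where "openin X U" "openin X V" "c \<in> U" "a \<in> V" "disjnt U V"
      using assms(2) C unfolding Hausdorff_space_def by blast
    then have "a \<notin> X closure_of U"
      unfolding in_closure_of disjnt_def by blast
    then show ?thesis
      using \<open>openin X U\<close> \<open>c \<in> U\<close> by auto
  qed
  then obtain G where G: "openin X G" "C \<subseteq> G" "disjnt {a} (X closure_of G)"
    using paracompact_separation[OF assms(1), of C "{a}"] C by blast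
  have "disjnt (topspace X - X closure_of G) G"
    using closure_of_subset[OF openin_subset[OF G(1)]] by (auto simp: disjnt_def)
  then show "\<exists>U V. openin X U \<and> openin X V \<and> a \<in> U \<and> C \<subseteq> V \<and> disjnt U V"
    using G C by (intro exI[of _ "topspace X - X closure_of G"] exI[of _ G]) auto
qed

lemma paracompact_Hausdorff_imp_normal_space:
  assumes "paracompact_space X" "Hausdorff_space X"
  shows "normal_space X"
  unfolding normal_space
proof (intro allI impI)
  fix S T assume ST: "closedin X S \<and> closedin X T \<and> disjnt S T"
  have "\<exists>W. openin X W \<and> c \<in> W \<and> disjnt T (X closure_of W)" if "c \<in> S" for c
  proof -
    have "c \<in> topspace X - T"
      using ST that closedin_subset by (fastforce simp: disjnt_iff)
    then show ?thesis
      using paracompact_Hausdorff_imp_regular_space[OF assms] ST unfolding regular_space by blast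
  qed
  then show "\<exists>U. openin X U \<and> S \<subseteq> U \<and> disjnt T (X closure_of U)"
    using paracompact_separation[OF assms(1)] ST by blast
qed

text \<open>Local finiteness counts indices here, not sets: different indices may carry the same
  set, and the sums below run over indices.\<close>

definition locally_finite_family :: "'a topology \<Rightarrow> 'i set \<Rightarrow> ('i \<Rightarrow> 'a set) \<Rightarrow> bool" where
  "locally_finite_family X I G \<longleftrightarrow>
     (\<forall>x\<in>topspace X. \<exists>N. openin X N \<and> x \<in> N \<and> finite {i \<in> I. G i \<inter> N \<noteq> {}})"

lemma locally_finite_familyE:
  assumes "locally_finite_family X I G" "x \<in> topspace X"
  obtains N where "openin X N" "x \<in> N" "finite {i \<in> I. G i \<inter> N \<noteq> {}}"
  using assms unfolding locally_finite_family_def by metis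

text \<open>Regularity gives a cover by open sets whose closures lie in some \<open>A i\<close>. A
  locally finite refinement is regrouped along a choice \<open>j\<close> of such indices, so that
  the result is indexed by \<open>I\<close> itself; grouping a locally finite cover neither spoils
  local finiteness nor enlarges closures.\<close>

lemma paracompact_shrinking:
  assumes "paracompact_space X" "Hausdorff_space X"
    and A: "\<And>i. i \<in> I \<Longrightarrow> openin X (A i)" "(\<Union>i\<in>I. A i) = topspace X"
  obtains G where "\<And>i. i \<in> I \<Longrightarrow> openin X (G i)" "\<And>i. i \<in> I \<Longrightarrow> X closure_of (G i) \<subseteq> A i"
    "(\<Union>i\<in>I. G i) = topspace X" "locally_finite_family X I G"
proof -
  define \<U> where "\<U> = {W. openin X W \<and> (\<exists>i\<in>I. X closure_of W \<subseteq> A i)}"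
  have "open_cover X \<U>"
    unfolding open_cover_def
  proof
    show "\<forall>U\<in>\<U>. openin X U" by (auto simp: \<U>_def)
    then have "\<Union>\<U> \<subseteq> topspace X"
      using openin_subset by blast
    moreover have "x \<in> \<Union>\<U>" if "x \<in> topspace X" for x
    proof -
      have "x \<in> (\<Union>i\<in>I. A i)" using that A(2) by simp
      then obtain i where i: "i \<in> I" "x \<in> A i" by blast
      then have "closedin X (topspace X - A i)" "x \<in> topspace X - (topspace X - A i)"
        using A(1) that by blast+
      then obtain W where W: "openin X W" "x \<in> W" "disjnt (topspace X - A i) (X closure_of W)"
        using paracompact_Hausdorff_imp_regular_space[OF assms(1,2)] unfolding regular_space by blast
      then have "X closure_of W \<subseteq> A i"
        using closure_of_subset_topspace[of X W] by (auto simp: disjnt_iff)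
      then show ?thesis
        using W i unfolding \<U>_def by blast
    qed
    ultimately show "\<Union>\<U> = topspace X" by blast
  qed
  then obtain \<V> where \<V>: "open_cover X \<V>" "cover_refines \<V> \<U>" "locally_finite_in X \<V>"
    using assms(1) unfolding paracompact_space_def by blast
  have "\<exists>i\<in>I. X closure_of V \<subseteq> A i" if "V \<in> \<V>" for V
  proof -
    obtain U where "U \<in> \<U>" "V \<subseteq> U"
      using \<V>(2) \<open>V \<in> \<V>\<close> unfolding cover_refines_def by meson
    then obtain i where "i \<in> I" "X closure_of U \<subseteq> A i"
      by (auto simp: \<U>_def)
    then show ?thesis
      using closure_of_mono[OF \<open>V \<subseteq> U\<close>] by (meson subset_trans)
  qed
  then obtain j where j: "\<And>V. V \<in> \<V> \<Longrightarrow> j V \<in> I" "\<And>V. V \<in> \<V> \<Longrightarrow> X closure_of V \<subseteq> A (j V)"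
    by metis
  define G where "G i = \<Union>{V \<in> \<V>. j V = i}" for i
  show ?thesis
  proof
    show "openin X (G i)" for i
      using \<V>(1) unfolding G_def open_cover_def by (intro openin_Union) auto
    show "X closure_of (G i) \<subseteq> A i" if "i \<in> I" for i
    proof -
      have "locally_finite_in X {V \<in> \<V>. j V = i}"
        using \<V>(3) by (rule locally_finite_in_subset) auto
      then have "X closure_of (G i) = (\<Union>V\<in>{V \<in> \<V>. j V = i}. X closure_of V)"
        unfolding G_def by (rule closure_of_locally_finite_Union)
      then show ?thesis using j(2) by auto
    qed
    have "(\<Union>i\<in>I. G i) = \<Union>\<V>"
      using j(1) unfolding G_def by blast
    then show "(\<Union>i\<in>I. G i) = topspace X"
      using \<V>(1) by (simp add: open_cover_def)
    show "locally_finite_family X I G"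
      unfolding locally_finite_family_def
    proof
      fix x assume "x \<in> topspace X"
      then obtain N where N: "openin X N" "x \<in> N" "finite {V \<in> \<V>. V \<inter> N \<noteq> {}}"
        using \<V>(3) unfolding locally_finite_in_def by blast
      have "{i \<in> I. G i \<inter> N \<noteq> {}} \<subseteq> j ` {V \<in> \<V>. V \<inter> N \<noteq> {}}"
        unfolding G_def by blast
      then have "finite {i \<in> I. G i \<inter> N \<noteq> {}}"
        using N(3) finite_surj by blast
      with N show "\<exists>N. openin X N \<and> x \<in> N \<and> finite {i \<in> I. G i \<inter> N \<noteq> {}}" by blast
    qed
  qed
qed

section \<open>Partitions of unity\<close>

lemma continuous_map_locally_finite_sum:
  fixes f :: "'i \<Rightarrow> 'a \<Rightarrow> real"
  assumes cont: "\<And>i. i \<in> I \<Longrightarrow> continuous_map X euclideanreal (f i)"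
    and lf: "\<And>x. x \<in> topspace X \<Longrightarrow> \<exists>N. openin X N \<and> x \<in> N \<and> finite {i \<in> I. \<exists>y\<in>N. f i y \<noteq> 0}"
  shows "continuous_map X euclideanreal (\<lambda>x. \<Sum>i | i \<in> I \<and> f i x \<noteq> 0. f i x)"
proof (rule continuous_map_locally)
  fix x assume "x \<in> topspace X"
  then obtain N where N: "openin X N" "x \<in> N" "finite {i \<in> I. \<exists>y\<in>N. f i y \<noteq> 0}"
    using lf by blast
  \<comment> \<open>The index set of the sum depends on the point; on \<open>N\<close> it may be
    replaced by this fixed finite set.\<close>
  let ?J = "{i \<in> I. \<exists>y\<in>N. f i y \<noteq> 0}"
  have "continuous_map (subtopology X N) euclideanreal (\<lambda>y. \<Sum>i\<in>?J. f i y)"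
    using N(3) cont by (intro continuous_map_sum continuous_map_from_subtopology) auto
  moreover have "(\<Sum>i\<in>?J. f i y) = (\<Sum>i | i \<in> I \<and> f i y \<noteq> 0. f i y)"
    if "y \<in> topspace (subtopology X N)" for y
    using that N(3) by (intro sum.mono_neutral_right) auto
  ultimately have "continuous_map (subtopology X N) euclideanreal (\<lambda>y. \<Sum>i | i \<in> I \<and> f i y \<noteq> 0. f i y)"
    by (rule continuous_map_eq)
  with N show "\<exists>N. openin X N \<and> x \<in> N \<and>
      continuous_map (subtopology X N) euclideanreal (\<lambda>x. \<Sum>i | i \<in> I \<and> f i x \<noteq> 0. f i x)"
    by blast
qed

text \<open>Shrinking twice leaves room for Urysohn functions whose supports are still locally finite.\<close>

lemma subordinate_partition_exists:
  assumes "paracompact_space X" "Hausdorff_space X" "open_cover X \<U>"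
  shows "\<exists>\<phi>. subordinate_partition X \<U> \<phi>"
proof -
  have \<U>: "\<And>U. U \<in> \<U> \<Longrightarrow> openin X U" "(\<Union>U\<in>\<U>. U) = topspace X"
    using assms(3) by (auto simp: open_cover_def)
  obtain G where G: "\<And>U. U \<in> \<U> \<Longrightarrow> openin X (G U)" "\<And>U. U \<in> \<U> \<Longrightarrow> X closure_of (G U) \<subseteq> U"
    "(\<Union>U\<in>\<U>. G U) = topspace X" "locally_finite_family X \<U> G"
    using paracompact_shrinking[OF assms(1,2) \<U>] by metis
  obtain H where H: "\<And>U. U \<in> \<U> \<Longrightarrow> openin X (H U)" "\<And>U. U \<in> \<U> \<Longrightarrow> X closure_of (H U) \<subseteq> G U"
    "(\<Union>U\<in>\<U>. H U) = topspace X"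
    using paracompact_shrinking[OF assms(1,2) G(1,3)] by metis
  \<comment> \<open>Vanishing off \<open>G U\<close> keeps the supports locally finite and their
    closures inside \<open>U\<close>; the value 1 on \<open>H U\<close> makes the sum
    \<open>\<sigma>\<close> positive everywhere, since the sets \<open>H U\<close> still
    cover.\<close>
  have "\<exists>f. continuous_map X (top_of_set {0..1::real}) f \<and> f ` (topspace X - G U) \<subseteq> {0} \<and>
      f ` (X closure_of H U) \<subseteq> {1}" if "U \<in> \<U>" for U
  proof -
    have "closedin X (topspace X - G U)" "disjnt (topspace X - G U) (X closure_of H U)"
      using G(1) H(2) that by (auto simp: disjnt_iff)
    then show ?thesis
      using Urysohn_lemma[OF paracompact_Hausdorff_imp_normal_space[OF assms(1,2)], of _ _ 0 1]
      by (metis closedin_closure_of zero_le_one)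
  qed
  then obtain f where f: "\<And>U. U \<in> \<U> \<Longrightarrow> continuous_map X (top_of_set {0..1::real}) (f U)"
    "\<And>U. U \<in> \<U> \<Longrightarrow> f U ` (topspace X - G U) \<subseteq> {0}"
    "\<And>U. U \<in> \<U> \<Longrightarrow> f U ` (X closure_of H U) \<subseteq> {1}"
    by metis
  have f01: "0 \<le> f U x" if "U \<in> \<U>" "x \<in> topspace X" for U x
    using f(1)[OF that(1)] that(2) by (auto simp: continuous_map_in_subtopology image_subset_iff Pi_iff)
  have fcont: "continuous_map X euclideanreal (f U)" if "U \<in> \<U>" for U
    using f(1)[OF that] by (simp add: continuous_map_in_subtopology)
  have fG: "x \<in> G U" if "U \<in> \<U>" "x \<in> topspace X" "f U x \<noteq> 0" for U x
    using f(2)[OF that(1)] that by blast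
  have lf: "\<exists>N. openin X N \<and> x \<in> N \<and> finite {U \<in> \<U>. \<exists>y\<in>N. f U y \<noteq> 0}" if "x \<in> topspace X" for x
  proof -
    obtain N where N: "openin X N" "x \<in> N" "finite {U \<in> \<U>. G U \<inter> N \<noteq> {}}"
      by (rule locally_finite_familyE[OF G(4) \<open>x \<in> topspace X\<close>])
    have "{U \<in> \<U>. \<exists>y\<in>N. f U y \<noteq> 0} \<subseteq> {U \<in> \<U>. G U \<inter> N \<noteq> {}}"
      using fG openin_subset[OF N(1)] by blast
    then show ?thesis
      using N finite_subset by blast
  qed
  define \<sigma> where "\<sigma> x = (\<Sum>U | U \<in> \<U> \<and> f U x \<noteq> 0. f U x)" for x
  have \<sigma>cont: "continuous_map X euclideanreal \<sigma>"
    unfolding \<sigma>_def using fcont lf by (rule continuous_map_locally_finite_sum)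
  have \<sigma>pos: "0 < \<sigma> x" if x: "x \<in> topspace X" for x
  proof -
    obtain U where U: "U \<in> \<U>" "x \<in> H U" using H(3) x by blast
    then have "f U x = 1"
      using f(3)[OF U(1)] closure_of_subset[OF openin_subset[OF H(1)[OF U(1)]]] by blast
    moreover have "finite {U \<in> \<U>. f U x \<noteq> 0}"
    proof -
      obtain N where "x \<in> N" "finite {U \<in> \<U>. \<exists>y\<in>N. f U y \<noteq> 0}"
        using lf[OF x] by blast
      then show ?thesis by (rule_tac finite_subset[rotated]) auto
    qed
    ultimately show ?thesis
      unfolding \<sigma>_def using U f01[OF _ x]
      by (intro sum_pos2[of _ U]) auto
  qed
  have nz: "f U x / \<sigma> x \<noteq> 0 \<longleftrightarrow> f U x \<noteq> 0" if "x \<in> topspace X" for U x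
    using \<sigma>pos[OF that] by simp
  have "subordinate_partition X \<U> (\<lambda>U x. f U x / \<sigma> x)"
    unfolding subordinate_partition_def
  proof (intro conjI ballI)
    fix U assume U: "U \<in> \<U>"
    show "continuous_map X euclideanreal (\<lambda>x. f U x / \<sigma> x)"
      using \<sigma>pos fcont[OF U] \<sigma>cont by (intro continuous_map_real_divide) force+
    show "0 \<le> f U x / \<sigma> x" if "x \<in> topspace X" for x
      using f01[OF U that] \<sigma>pos[OF that] by simp
    have "{x \<in> topspace X. f U x / \<sigma> x \<noteq> 0} \<subseteq> G U"
      using fG[OF U] by auto
    then show "X closure_of {x \<in> topspace X. f U x / \<sigma> x \<noteq> 0} \<subseteq> U"
      using closure_of_mono G(2)[OF U] by blast
  next
    fix x assume x: "x \<in> topspace X"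
    obtain N where N: "openin X N" "x \<in> N" "finite {U \<in> \<U>. \<exists>y\<in>N. f U y \<noteq> 0}"
      using lf[OF x] by blast
    moreover have "finite {U \<in> \<U>. \<exists>y\<in>N. f U y / \<sigma> y \<noteq> 0}"
      by (rule finite_subset[OF _ N(3)]) auto
    ultimately show "\<exists>N. openin X N \<and> x \<in> N \<and> finite {U \<in> \<U>. \<exists>y\<in>N. f U y / \<sigma> y \<noteq> 0}"
      by blast
    have "(\<Sum>U | U \<in> \<U> \<and> f U x / \<sigma> x \<noteq> 0. f U x / \<sigma> x) = \<sigma> x / \<sigma> x"
      unfolding nz[OF x] sum_divide_distrib[symmetric] by (simp only: \<sigma>_def)
    then show "(\<Sum>U | U \<in> \<U> \<and> f U x / \<sigma> x \<noteq> 0. f U x / \<sigma> x) = 1"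
      using \<sigma>pos[OF x] by simp
  qed
  then show ?thesis by blast
qed

text \<open>This is the barycentric refinement. If \<open>y\<close> lies in \<open>B x\<close> and
  in \<open>G U\<close>, then \<open>x\<close> lies in the closure of \<open>G U\<close>, since
  otherwise that closure, and \<open>y\<close> with it, would have been removed from
  \<open>B x\<close>; hence \<open>B x\<close> is contained in \<open>U\<close>. As \<open>U\<close>
  was chosen from \<open>y\<close> alone, it serves all members around \<open>y\<close>.\<close>

lemma point_star_refinement_exists:
  assumes "paracompact_space X" "Hausdorff_space X" "open_cover X \<U>"
  obtains \<B> where "open_cover X \<B>"
    "\<And>y. y \<in> topspace X \<Longrightarrow> \<exists>U\<in>\<U>. \<forall>B\<in>\<B>. y \<in> B \<longrightarrow> B \<subseteq> U"
proof -
  have \<U>: "\<And>U. U \<in> \<U> \<Longrightarrow> openin X U" "(\<Union>U\<in>\<U>. U) = topspace X"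
    using assms(3) by (auto simp: open_cover_def)
  obtain G where G: "\<And>U. U \<in> \<U> \<Longrightarrow> openin X (G U)" "\<And>U. U \<in> \<U> \<Longrightarrow> X closure_of (G U) \<subseteq> U"
    "(\<Union>U\<in>\<U>. G U) = topspace X" "locally_finite_family X \<U> G"
    using paracompact_shrinking[OF assms(1,2) \<U>] by metis
  \<comment> \<open>Local finiteness enters twice: only finitely many closures contain
    \<open>x\<close>, so the intersection is open, and the removed union of closures is
    closed.\<close>
  define B where "B x = (topspace X \<inter> \<Inter>{U \<in> \<U>. x \<in> X closure_of (G U)}) -
      \<Union>((\<lambda>S. X closure_of S) ` G ` {U \<in> \<U>. x \<notin> X closure_of (G U)})" for x
  have "openin X (B x)" if x: "x \<in> topspace X" for x
    unfolding B_def
  proof (rule openin_diff)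
    obtain N where N: "openin X N" "x \<in> N" "finite {U \<in> \<U>. G U \<inter> N \<noteq> {}}"
      by (rule locally_finite_familyE[OF G(4) x])
    have "{U \<in> \<U>. x \<in> X closure_of (G U)} \<subseteq> {U \<in> \<U>. G U \<inter> N \<noteq> {}}"
      using N by (auto simp: in_closure_of)
    then have "finite {U \<in> \<U>. x \<in> X closure_of (G U)}"
      using N(3) finite_subset by blast
    then show "openin X (topspace X \<inter> \<Inter>{U \<in> \<U>. x \<in> X closure_of (G U)})"
      using \<U>(1) openin_Int_Inter[of "{U \<in> \<U>. x \<in> X closure_of (G U)}" X "topspace X"] by auto
    have "locally_finite_in X (G ` {U \<in> \<U>. x \<notin> X closure_of (G U)})"
      unfolding locally_finite_in_def
    proof (intro conjI ballI)
      show "\<Union>(G ` {U \<in> \<U>. x \<notin> X closure_of (G U)}) \<subseteq> topspace X"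
        using G(1) openin_subset by blast
      fix z assume z: "z \<in> topspace X"
      obtain M where M: "openin X M" "z \<in> M" "finite {U \<in> \<U>. G U \<inter> M \<noteq> {}}"
        by (rule locally_finite_familyE[OF G(4) z])
      have "{S \<in> G ` {U \<in> \<U>. x \<notin> X closure_of (G U)}. S \<inter> M \<noteq> {}} \<subseteq> G ` {U \<in> \<U>. G U \<inter> M \<noteq> {}}"
        by blast
      then have "finite {S \<in> G ` {U \<in> \<U>. x \<notin> X closure_of (G U)}. S \<inter> M \<noteq> {}}"
        using M(3) finite_surj by blast
      with M show "\<exists>V. openin X V \<and> z \<in> V \<and>
          finite {S \<in> G ` {U \<in> \<U>. x \<notin> X closure_of (G U)}. S \<inter> V \<noteq> {}}"
        by blast
    qed
    then show "closedin X (\<Union>((\<lambda>S. X closure_of S) ` G ` {U \<in> \<U>. x \<notin> X closure_of (G U)}))"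
      by (rule closedin_Union_locally_finite_closure)
  qed
  moreover have "x \<in> B x" if "x \<in> topspace X" for x
    using that G(2) unfolding B_def by blast
  moreover have "B x \<subseteq> topspace X" for x
    unfolding B_def by blast
  ultimately have "open_cover X (B ` topspace X)"
    unfolding open_cover_def by blast
  moreover have "\<exists>U\<in>\<U>. \<forall>C\<in>B ` topspace X. y \<in> C \<longrightarrow> C \<subseteq> U" if "y \<in> topspace X" for y
  proof -
    obtain U where U: "U \<in> \<U>" "y \<in> G U" using G(3) \<open>y \<in> topspace X\<close> by blast
    then have y: "y \<in> X closure_of (G U)"
      using closure_of_subset[OF openin_subset[OF G(1)]] by blast
    have "B x \<subseteq> U" if "y \<in> B x" for x
    proof -
      have "x \<in> X closure_of (G U)"
        using that y U(1) unfolding B_def by blast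
      then show ?thesis
        using U(1) unfolding B_def by blast
    qed
    then show ?thesis
      using U(1) by blast
  qed
  ultimately show ?thesis
    by (rule that)
qed

text \<open>Only \<open>V0\<close> contains the basepoint, so every subordinate partition of unity takes the
  value 1 there.\<close>

lemma path_connected_point_star_refinement:
  assumes "paracompact_space X" "Hausdorff_space X" "locally_path_connected_space X"
    and "open_cover X \<U>" "x0 \<in> topspace X"
  obtains \<V> V0 where "(\<V>, V0) \<in> shape_index X x0" "\<And>V. V \<in> \<V> \<Longrightarrow> path_connectedin X V"
    "\<And>y. y \<in> topspace X \<Longrightarrow> \<exists>U\<in>\<U>. \<forall>V\<in>\<V>. y \<in> V \<longrightarrow> V \<subseteq> U"
proof -
  obtain \<B> where \<B>: "open_cover X \<B>"
    "\<And>y. y \<in> topspace X \<Longrightarrow> \<exists>U\<in>\<U>. \<forall>B\<in>\<B>. y \<in> B \<longrightarrow> B \<subseteq> U"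
    using point_star_refinement_exists[OF assms(1,2,4)] by blast
  have B: "\<exists>B\<in>\<B>. openin X B \<and> x \<in> B" if "x \<in> topspace X" for x
    using that \<B>(1) unfolding open_cover_def by blast
  note lpc = assms(3)[unfolded locally_path_connected_space, rule_format]
  obtain B0 where B0: "B0 \<in> \<B>" "openin X B0" "x0 \<in> B0"
    using B assms(5) by blast
  obtain V0 where V0: "openin X V0" "path_connectedin X V0" "x0 \<in> V0" "V0 \<subseteq> B0"
    using lpc B0 by blast
  \<comment> \<open>Points are closed, so every point other than \<open>x0\<close> still has path
    connected open neighbourhoods avoiding \<open>x0\<close>. All members lie in members of \<B> and
    thus inherit its control around each point.\<close>
  define \<V> where "\<V> = insert V0 {C. openin X C \<and> path_connectedin X C \<and> x0 \<notin> C \<and> (\<exists>B\<in>\<B>. C \<subseteq> B)}"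
  have cover: "open_cover X \<V>"
    unfolding open_cover_def
  proof
    show op: "\<forall>V\<in>\<V>. openin X V" using V0 by (auto simp: \<V>_def)
    have "y \<in> \<Union>\<V>" if y: "y \<in> topspace X" for y
    proof (cases "y = x0")
      case False
      obtain B where B: "B \<in> \<B>" "openin X B" "y \<in> B" using B y by blast
      have "closedin X {x0}"
        using Hausdorff_imp_t1_space[OF assms(2)] assms(5) by (simp add: t1_space_closedin_singleton)
      then have "openin X (B - {x0})" using B(2) by (rule openin_diff[rotated])
      then obtain C where "openin X C" "path_connectedin X C" "y \<in> C" "C \<subseteq> B - {x0}"
        using lpc B False by blast
      then show ?thesis using B(1) unfolding \<V>_def by blast
    qed (use V0 in \<open>auto simp: \<V>_def\<close>)
    moreover have "\<Union>\<V> \<subseteq> topspace X" using op openin_subset by blast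
    ultimately show "\<Union>\<V> = topspace X" by blast
  qed
  obtain \<phi> where \<phi>: "subordinate_partition X \<V> \<phi>"
    using subordinate_partition_exists[OF assms(1,2) cover] by blast
  have "\<phi> V x0 = 0" if "V \<in> \<V>" "V \<noteq> V0" for V
  proof (rule ccontr)
    assume "\<phi> V x0 \<noteq> 0"
    then have "x0 \<in> X closure_of {x \<in> topspace X. \<phi> V x \<noteq> 0}"
      using closure_of_subset[of "{x \<in> topspace X. \<phi> V x \<noteq> 0}" X] assms(5) by blast
    then have "x0 \<in> V"
      using \<phi> that(1) unfolding subordinate_partition_def by blast
    then show False using that by (auto simp: \<V>_def)
  qed
  then have "{V. V \<in> \<V> \<and> \<phi> V x0 \<noteq> 0} \<subseteq> {V0}" by blast
  then have "(\<Sum>V | V \<in> \<V> \<and> \<phi> V x0 \<noteq> 0. \<phi> V x0) = (\<Sum>V\<in>{V0}. \<phi> V x0)"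
    by (intro sum.mono_neutral_left) (auto simp: \<V>_def)
  then have "\<phi> V0 x0 = 1"
    using \<phi> assms(5) by (simp add: subordinate_partition_def)
  then have "(\<V>, V0) \<in> shape_index X x0"
    using cover \<phi> V0 unfolding shape_index_def by (auto simp: \<V>_def)
  moreover have "path_connectedin X V" if "V \<in> \<V>" for V
    using that V0 by (auto simp: \<V>_def)
  moreover have "\<exists>U\<in>\<U>. \<forall>V\<in>\<V>. y \<in> V \<longrightarrow> V \<subseteq> U" if "y \<in> topspace X" for y
  proof -
    obtain U where U: "U \<in> \<U>" "\<forall>B\<in>\<B>. y \<in> B \<longrightarrow> B \<subseteq> U" using \<B>(2) \<open>y \<in> topspace X\<close> by blast
    have "\<exists>B\<in>\<B>. V \<subseteq> B" if "V \<in> \<V>" for V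
      using that V0 B0 unfolding \<V>_def by blast
    then show ?thesis using U by (meson subset_iff)
  qed
  ultimately show ?thesis by (rule that)
qed

section \<open>Canonical maps and the shape map\<close>

lemma nerve_finite: "S \<in> nerve \<U> \<Longrightarrow> finite S"
  by (simp add: nerve_def)

lemma nerve_Un:
  assumes "S \<in> nerve \<U>" "T \<in> nerve \<U>" "x \<in> \<Inter>(S \<union> T)"
  shows "S \<union> T \<in> nerve \<U>"
proof -
  have "\<Inter>(S \<union> T) \<noteq> {}" using assms(3) by blast
  then show ?thesis using assms(1,2) by (simp add: nerve_def)
qed

lemma shape_index_basepoint: "u \<in> shape_index X x0 \<Longrightarrow> x0 \<in> topspace X"
  unfolding shape_index_def open_cover_def by blast

text \<open>The functions of the partition of unity are taken as barycentric coordinates. Their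
  supports lie in the members of the cover, so the members with nonzero coordinate at
  \<open>x\<close> all contain \<open>x\<close>: this gives both a simplex of the nerve and the star
  condition. Local finiteness of the partition gives continuity.\<close>

lemma canonical_map_exists:
  assumes "u \<in> shape_index X x0"
  shows "\<exists>p. canonical_map X x0 u p"
proof -
  obtain \<U> U0 where u: "u = (\<U>, U0)" by (cases u)
  obtain \<phi> where U0: "U0 \<in> \<U>" and \<phi>: "subordinate_partition X \<U> \<phi>" "\<phi> U0 x0 = 1"
    using assms unfolding u shape_index_def by auto
  have x0: "x0 \<in> topspace X" using assms by (rule shape_index_basepoint)
  define p where "p x = (\<lambda>U. if U \<in> \<U> then \<phi> U x else 0)" for x
  have supp: "{U. p x U \<noteq> 0} = {U. U \<in> \<U> \<and> \<phi> U x \<noteq> 0}" for x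
    by (auto simp: p_def)
  have lf: "\<exists>N. openin X N \<and> x \<in> N \<and> finite {U\<in>\<U>. \<exists>y\<in>N. \<phi> U y \<noteq> 0}" if "x \<in> topspace X" for x
    using \<phi>(1) that by (simp add: subordinate_partition_def)
  have sum1: "(\<Sum>U | U \<in> \<U> \<and> \<phi> U x \<noteq> 0. \<phi> U x) = 1" if "x \<in> topspace X" for x
    using \<phi>(1) that by (simp add: subordinate_partition_def)
  have fin: "finite {U. U \<in> \<U> \<and> \<phi> U x \<noteq> 0}" if "x \<in> topspace X" for x
    using sum1[OF that] by (rule contrapos_pp) simp
  have nonneg: "0 \<le> p x U" if "x \<in> topspace X" for x U
    using \<phi>(1) that by (simp add: p_def subordinate_partition_def)
  have inU: "x \<in> U" if x: "x \<in> topspace X" and U: "p x U \<noteq> 0" for x U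
  proof -
    have "U \<in> \<U>" "\<phi> U x \<noteq> 0" using U by (auto simp: p_def split: if_splits)
    then have "x \<in> X closure_of {x \<in> topspace X. \<phi> U x \<noteq> 0}"
      using x closure_of_subset[of "{x \<in> topspace X. \<phi> U x \<noteq> 0}" X] by auto
    then show ?thesis
      using \<phi>(1) \<open>U \<in> \<U>\<close> unfolding subordinate_partition_def by auto
  qed
  have real: "p x \<in> realization_set (nerve \<U>)" if x: "x \<in> topspace X" for x
  proof -
    have sum: "(\<Sum>U | U \<in> \<U> \<and> \<phi> U x \<noteq> 0. p x U) = 1"
      using sum1[OF x] by (simp add: p_def)
    then have "{U. U \<in> \<U> \<and> \<phi> U x \<noteq> 0} \<noteq> {}"
      by (metis (no_types, lifting) sum.empty zero_neq_one)
    moreover have "x \<in> \<Inter>{U. U \<in> \<U> \<and> \<phi> U x \<noteq> 0}"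
      using inU[OF x] supp[of x] by auto
    ultimately have "{U. U \<in> \<U> \<and> \<phi> U x \<noteq> 0} \<in> nerve \<U>"
      using fin[OF x] unfolding nerve_def by auto
    then show ?thesis
      unfolding realization_set_def using nonneg[OF x] sum by (simp add: supp)
  qed
  have cont: "continuous_map X (realization (nerve \<U>)) p"
  proof (rule continuous_map_locally)
    fix x assume "x \<in> topspace X"
    then obtain N where N: "openin X N" "x \<in> N" "finite {U\<in>\<U>. \<exists>y\<in>N. \<phi> U y \<noteq> 0}"
      using lf by blast
    have "continuous_map (subtopology X N) (realization (nerve \<U>)) p"
    proof (rule continuous_map_into_realization[OF N(3)])
      show "p y \<in> realization_set (nerve \<U>)" if "y \<in> topspace (subtopology X N)" for y
        using real that by auto
      show "{U. p y U \<noteq> 0} \<subseteq> {U\<in>\<U>. \<exists>y\<in>N. \<phi> U y \<noteq> 0}" if "y \<in> topspace (subtopology X N)" for y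
        unfolding supp using that by auto
      show "continuous_map (subtopology X N) euclideanreal (\<lambda>x. p x U)"
        if "U \<in> {U\<in>\<U>. \<exists>y\<in>N. \<phi> U y \<noteq> 0}" for U
        using that \<phi>(1) unfolding subordinate_partition_def p_def
        by (auto intro: continuous_map_from_subtopology)
    qed
    with N show "\<exists>N. openin X N \<and> x \<in> N \<and> continuous_map (subtopology X N) (realization (nerve \<U>)) p"
      by blast
  qed
  \<comment> \<open>The coordinate of \<open>U0\<close> is already 1 and the others are nonnegative
    with total 0, so they vanish.\<close>
  have "p x0 = vertex U0"
  proof
    fix U
    let ?S = "{U. U \<in> \<U> \<and> \<phi> U x0 \<noteq> 0}"
    have "p x0 U0 = 1" using U0 \<phi>(2) by (simp add: p_def)
    have "(\<Sum>U\<in>?S. p x0 U) = 1"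
      using sum1[OF x0] by (simp add: p_def)
    moreover have "(\<Sum>U\<in>?S. p x0 U) = p x0 U0 + (\<Sum>U\<in>?S - {U0}. p x0 U)"
      using U0 \<phi>(2) fin[OF x0] by (intro sum.remove) auto
    ultimately have "(\<Sum>U\<in>?S - {U0}. p x0 U) = 0"
      using \<open>p x0 U0 = 1\<close> by simp
    then have "\<forall>U\<in>?S - {U0}. p x0 U = 0"
      using fin[OF x0] nonneg[OF x0] by (subst (asm) sum_nonneg_eq_0_iff) auto
    then show "p x0 U = vertex U0 U"
      using \<open>p x0 U0 = 1\<close> by (auto simp: vertex_def p_def)
  qed
  then have "canonical_map X x0 u p"
    unfolding canonical_map_def nerve_space_def u
    using cont inU by (auto simp: open_star_def)
  then show ?thesis by blast
qed

text \<open>This is the star condition in coordinates, the form in which it is used: all simplices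
  that canonical maps assign to \<open>x\<close> consist of sets with the common point
  \<open>x\<close>.\<close>

lemma canonical_map_support:
  assumes "canonical_map X x0 u p" "x \<in> topspace X"
  shows "p x \<in> realization_set (nerve (fst u))" "{U. p x U \<noteq> 0} \<in> nerve (fst u)"
    "{U. p x U \<noteq> 0} \<subseteq> {U \<in> fst u. x \<in> U}"
proof -
  show real: "p x \<in> realization_set (nerve (fst u))"
    using assms unfolding canonical_map_def nerve_space_def continuous_map_def by auto
  then show nerve: "{U. p x U \<noteq> 0} \<in> nerve (fst u)"
    by (simp add: realization_set_def)
  show "{U. p x U \<noteq> 0} \<subseteq> {U \<in> fst u. x \<in> U}"
  proof
    fix U assume U: "U \<in> {U. p x U \<noteq> 0}"
    then have "U \<in> fst u" using nerve unfolding nerve_def by blast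
    moreover have "p x \<in> open_star (nerve (fst u)) U"
      using U real by (simp add: open_star_def)
    ultimately show "U \<in> {U \<in> fst u. x \<in> U}"
      using assms unfolding canonical_map_def by blast
  qed
qed

section \<open>Simplicial maps between nerves and their compatibility with canonical maps\<close>

lemma simplicial_realization_vertex: "simplicial_realization f (vertex v) = vertex (f v)"
proof
  fix w
  have "{v'. vertex v v' \<noteq> 0 \<and> f v' = w} = (if f v = w then {v} else {})"
    by (auto simp: vertex_def)
  then show "simplicial_realization f (vertex v) w = vertex (f v) w"
    by (auto simp: simplicial_realization_def vertex_def)
qed

lemma vertex_assignment_exists:
  assumes "pointed_refines v u" "snd u \<in> fst u"
  shows "\<exists>f. vertex_assignment v u f"
proof -
  obtain g where g: "\<And>V. V \<in> fst v \<Longrightarrow> g V \<in> fst u \<and> V \<subseteq> g V"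
    using assms(1) unfolding pointed_refines_def cover_refines_def by metis
  \<comment> \<open>Redirecting the distinguished member to the distinguished one is allowed because
    a pointed refinement includes \<open>snd v \<subseteq> snd u\<close>.\<close>
  then have "vertex_assignment v u (g(snd v := snd u))"
    using assms unfolding vertex_assignment_def pointed_refines_def by auto
  then show ?thesis by blast
qed

lemma vertex_assignment_nerve:
  assumes "vertex_assignment v u f" "S \<in> nerve (fst v)"
  shows "f ` S \<in> nerve (fst u)"
proof -
  have S: "finite S" "S \<noteq> {}" "S \<subseteq> fst v" "\<Inter>S \<noteq> {}"
    using assms(2) by (auto simp: nerve_def)
  then obtain x where "x \<in> \<Inter>S" by blast
  then have "x \<in> \<Inter>(f ` S)"
    using assms(1) S(3) unfolding vertex_assignment_def by blast
  then show ?thesis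
    using S assms(1) unfolding nerve_def vertex_assignment_def by auto
qed

text \<open>At each parameter the simplices of both image loops consist of sets containing
  \<open>\<alpha> r\<close>, so together they span a simplex and the loops are contiguous. This is
  what places the values of the shape map in the inverse limit.\<close>

lemma bonding_canonical:
  assumes u: "u \<in> shape_index X x0"
    and "pointed_refines v u" "canonical_map X x0 u p" "canonical_map X x0 v q" "loop_at X x0 \<alpha>"
  shows "bonding u v (path_class (nerve_space v) (q \<circ> \<alpha>)) = path_class (nerve_space u) (p \<circ> \<alpha>)"
proof -
  define f where "f = (SOME f. vertex_assignment v u f)"
  have "snd u \<in> fst u" using u by (auto simp: shape_index_def)
  then have f: "vertex_assignment v u f"
    unfolding f_def using someI_ex[OF vertex_assignment_exists[OF assms(2)]] by simp
  have cont: "continuous_map X (nerve_space u) p" "continuous_map X (nerve_space v) q"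
    using assms by (auto simp: canonical_map_def)
  have sr: "continuous_map (nerve_space v) (nerve_space u) (simplicial_realization f)"
    unfolding nerve_space_def using nerve_finite vertex_assignment_nerve[OF f]
    by (rule continuous_map_simplicial_realization)
  have \<alpha>: "pathin X \<alpha>" "\<alpha> 0 = x0" "\<alpha> 1 = x0" using assms by (auto simp: loop_at_def)
  have paths: "pathin (nerve_space v) (q \<circ> \<alpha>)" "pathin (nerve_space u) (p \<circ> \<alpha>)"
    "pathin (nerve_space u) (simplicial_realization f \<circ> (q \<circ> \<alpha>))"
    using \<alpha>(1) cont sr by (blast intro: pathin_compose)+
  have ends: "simplicial_realization f (q x0) = p x0"
    using assms(3,4) f
    by (simp add: canonical_map_def simplicial_realization_vertex vertex_assignment_def)
  have "homotopic_paths_in (nerve_space u) (simplicial_realization f \<circ> (q \<circ> \<alpha>)) (p \<circ> \<alpha>)"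
    unfolding nerve_space_def
  proof (rule homotopic_paths_in_realization)
    show "pathin (realization (nerve (fst u))) (simplicial_realization f \<circ> (q \<circ> \<alpha>))"
      "pathin (realization (nerve (fst u))) (p \<circ> \<alpha>)"
      using paths by (simp_all add: nerve_space_def)
    fix r :: real assume "r \<in> {0..1}"
    then have x: "\<alpha> r \<in> topspace X"
      using path_image_subset_topspace[OF \<alpha>(1)] by blast
    note q = canonical_map_support[OF assms(4) x] and p = canonical_map_support[OF assms(3) x]
    have "f ` {V. q (\<alpha> r) V \<noteq> 0} \<in> nerve (fst u)"
      by (rule vertex_assignment_nerve[OF f q(2)])
    moreover have "\<alpha> r \<in> \<Inter>(f ` {V. q (\<alpha> r) V \<noteq> 0} \<union> {U. p (\<alpha> r) U \<noteq> 0})"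
      using q(3) p(3) f unfolding vertex_assignment_def by blast
    ultimately have "f ` {V. q (\<alpha> r) V \<noteq> 0} \<union> {U. p (\<alpha> r) U \<noteq> 0} \<in> nerve (fst u)"
      using p(2) by (intro nerve_Un)
    then show "{U. (simplicial_realization f \<circ> (q \<circ> \<alpha>)) r U \<noteq> 0} \<union> {U. (p \<circ> \<alpha>) r U \<noteq> 0} \<in> nerve (fst u)"
      by (simp add: simplicial_realization_support[OF q(1)])
  qed (use nerve_finite ends \<alpha> in auto)
  then show ?thesis
    unfolding bonding_def f_def[symmetric]
    by (simp add: induced_map_path_class[OF sr paths(1)] path_class_cong)
qed

text \<open>Names the canonical map hidden behind \<open>SOME\<close>. The clause for arbitrary
  \<open>A\<close> lets one \<open>p\<close> serve all classes simultaneously.\<close>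

lemma shape_map_apply:
  assumes "u \<in> shape_index X x0"
  obtains p where "canonical_map X x0 u p"
    "\<And>\<alpha>. loop_at X x0 \<alpha> \<Longrightarrow> shape_map X x0 (path_class X \<alpha>) u = path_class (nerve_space u) (p \<circ> \<alpha>)"
    "\<And>A. shape_map X x0 A u = induced_map (nerve_space u) p A"
proof -
  define p where "p = (SOME p. canonical_map X x0 u p)"
  have p: "canonical_map X x0 u p"
    unfolding p_def by (rule someI_ex[OF canonical_map_exists[OF assms]])
  have eq: "shape_map X x0 A u = induced_map (nerve_space u) p A" for A
    using assms by (simp add: shape_map_def p_def)
  have "shape_map X x0 (path_class X \<alpha>) u = path_class (nerve_space u) (p \<circ> \<alpha>)" if "loop_at X x0 \<alpha>" for \<alpha>
    unfolding eq using p that by (simp add: canonical_map_def induced_map_path_class loop_at_def)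
  then show ?thesis using that[OF p _ eq] by blast
qed

lemma shape_map_in_carrier:
  assumes "A \<in> carrier (fundamental_group X x0)"
  shows "shape_map X x0 A \<in> carrier (shape_group X x0)"
proof -
  obtain \<alpha> where \<alpha>: "loop_at X x0 \<alpha>" "A = path_class X \<alpha>"
    using assms by (auto simp: fundamental_group_carrier)
  have "shape_map X x0 A u \<in> carrier (nerve_group u)" if u: "u \<in> shape_index X x0" for u
  proof -
    obtain p where p: "canonical_map X x0 u p"
      "shape_map X x0 A u = path_class (nerve_space u) (p \<circ> \<alpha>)"
      using shape_map_apply[OF u] \<alpha> by metis
    then show ?thesis
      using loop_at_compose[OF _ \<alpha>(1), of "nerve_space u" p] unfolding nerve_group_def
      by (auto simp: canonical_map_def intro: path_class_in_carrier)
  qed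
  moreover have "bonding u v (shape_map X x0 A v) = shape_map X x0 A u"
    if u: "u \<in> shape_index X x0" and v: "v \<in> shape_index X x0" and "pointed_refines v u" for u v
  proof -
    obtain p q where "canonical_map X x0 u p" "shape_map X x0 A u = path_class (nerve_space u) (p \<circ> \<alpha>)"
      "canonical_map X x0 v q" "shape_map X x0 A v = path_class (nerve_space v) (q \<circ> \<alpha>)"
      using shape_map_apply[OF u] shape_map_apply[OF v] \<alpha> by metis
    then show ?thesis
      using bonding_canonical[OF u \<open>pointed_refines v u\<close>] \<alpha>(1) by simp
  qed
  ultimately show ?thesis
    by (auto simp: shape_group_def shape_map_def)
qed

text \<open>The shape map takes its values in the inverse limit, so restricting an open set of the
  product to that subspace does not change its preimage.\<close>

lemma openin_shape_topology:
  "openin (shape_topology X x0) W \<longleftrightarrow>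
    (\<exists>T. openin (product_topology (\<lambda>u. discrete_topology (carrier (nerve_group u))) (shape_index X x0)) T \<and>
      W = {A \<in> carrier (fundamental_group X x0). shape_map X x0 A \<in> T})"
  unfolding shape_topology_def openin_pullback_topology shape_group_topology_def openin_subtopology
proof (intro iffI; elim exE conjE)
  let ?P = "product_topology (\<lambda>u. discrete_topology (carrier (nerve_group u))) (shape_index X x0)"
  fix S T assume "W = shape_map X x0 -` S \<inter> carrier (fundamental_group X x0)"
    "openin ?P T" "S = T \<inter> carrier (shape_group X x0)"
  then show "\<exists>T. openin ?P T \<and> W = {A \<in> carrier (fundamental_group X x0). shape_map X x0 A \<in> T}"
    using shape_map_in_carrier by (intro exI[of _ T]) auto
next
  let ?P = "product_topology (\<lambda>u. discrete_topology (carrier (nerve_group u))) (shape_index X x0)"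
  fix T assume "openin ?P T" "W = {A \<in> carrier (fundamental_group X x0). shape_map X x0 A \<in> T}"
  then show "\<exists>S. (\<exists>T. openin ?P T \<and> S = T \<inter> carrier (shape_group X x0)) \<and>
      W = shape_map X x0 -` S \<inter> carrier (fundamental_group X x0)"
    using shape_map_in_carrier by (intro exI[of _ "T \<inter> carrier (shape_group X x0)"]) auto
qed

lemma topspace_shape_topology: "topspace (shape_topology X x0) = carrier (fundamental_group X x0)"
proof -
  let ?P = "product_topology (\<lambda>u. discrete_topology (carrier (nerve_group u))) (shape_index X x0)"
  have "carrier (shape_group X x0) \<subseteq> topspace ?P"
    by (auto simp: shape_group_def)
  then have "shape_map X x0 A \<in> topspace ?P" if "A \<in> carrier (fundamental_group X x0)" for A
    using shape_map_in_carrier[OF that] by (rule subsetD)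
  then have "carrier (fundamental_group X x0) = {A \<in> carrier (fundamental_group X x0). shape_map X x0 A \<in> topspace ?P}"
    by blast
  then have "openin (shape_topology X x0) (carrier (fundamental_group X x0))"
    unfolding openin_shape_topology using openin_topspace by blast
  moreover have "W \<subseteq> carrier (fundamental_group X x0)" if "openin (shape_topology X x0) W" for W
    using that unfolding openin_shape_topology by auto
  ultimately show ?thesis
    using openin_subset openin_topspace by blast
qed

section \<open>Spanier groups in the kernel of a canonical map\<close>

text \<open>The segment from \<open>y\<close> to a vertex of its carrier never leaves the carrier;
  the support bound is what contiguity arguments consume.\<close>

lemma path_to_vertex:
  assumes y: "y \<in> realization_set K" "y v \<noteq> 0" and v: "{v} \<in> K"
  obtains \<sigma> where "pathin (realization K) \<sigma>" "\<sigma> 0 = y" "\<sigma> 1 = vertex v"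
    "\<And>r. {w. \<sigma> r w \<noteq> 0} \<subseteq> {w. y w \<noteq> 0}"
proof -
  define \<sigma> where "\<sigma> r = (\<lambda>w. (1 - r) * y w + r * vertex v w)" for r
  have supp: "{w. \<sigma> r w \<noteq> 0} \<subseteq> {w. y w \<noteq> 0}" for r
    using y(2) by (auto simp: \<sigma>_def vertex_def)
  have union: "{w. y w \<noteq> 0} \<union> {w. vertex v w \<noteq> 0} = {w. y w \<noteq> 0}"
    using y(2) by (auto simp: vertex_def)
  have "continuous_map (top_of_set {0..1}) (realization K) \<sigma>"
  proof (rule continuous_map_into_realization[OF realization_set_finite[OF y(1)] _ supp])
    show "\<sigma> r \<in> realization_set K" if "r \<in> topspace (top_of_set {0..1})" for r
      unfolding \<sigma>_def using that y(1) vertex_in_realization_set[OF v] union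
      by (intro convex_combination_realization) (auto simp: realization_set_def)
    show "continuous_map (top_of_set {0..1}) euclideanreal (\<lambda>r. \<sigma> r w)" for w
      unfolding \<sigma>_def by (simp add: continuous_intros)
  qed
  then show ?thesis
    using that[of \<sigma>] supp by (simp add: \<sigma>_def pathin_def)
qed

text \<open>The loop is contiguous to the path that runs to the vertex, waits there and returns.\<close>

lemma loop_in_open_star_null_homotopic:
  assumes K: "\<And>S. S \<in> K \<Longrightarrow> finite S" and v: "{v} \<in> K"
    and q: "loop_at (realization K) y q" and star: "\<And>r. r \<in> {0..1} \<Longrightarrow> q r v \<noteq> 0"
  shows "homotopic_paths_in (realization K) q (\<lambda>_. y)"
proof -
  let ?R = "realization K"
  have pq: "pathin ?R q" "q 0 = y" "q 1 = y" using q by (auto simp: loop_at_def)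
  have in_real: "q r \<in> realization_set K" if "r \<in> {0..1}" for r
    using path_image_subset_topspace[OF pq(1)] that by auto
  have y: "y \<in> realization_set K" "y v \<noteq> 0"
    using in_real[of 0] star[of 0] pq(2) by auto
  obtain \<sigma> where \<sigma>: "pathin ?R \<sigma>" "\<sigma> 0 = y" "\<sigma> 1 = vertex v" "\<And>r. {w. \<sigma> r w \<noteq> 0} \<subseteq> {w. y w \<noteq> 0}"
    using path_to_vertex[OF y v] by metis
  have const_paths: "pathin ?R (\<lambda>_. y)" "pathin ?R (\<lambda>_. vertex v)"
    using y(1) vertex_in_realization_set[OF v] by (auto simp: pathin_const)
  \<comment> \<open>Padding \<open>q\<close> with waits synchronizes it with \<open>?M\<close>: up
    to time 1/2 one waits at \<open>y\<close> while the other travels to the vertex, between 1/2 and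
    3/4 the loop runs inside the star while the other waits, and then the roles return. At each time
    the support of \<open>?M\<close> is contained in that of \<open>?L\<close>.\<close>
  let ?L = "path_join (\<lambda>_. y) (path_join q (\<lambda>_. y))"
  let ?M = "path_join \<sigma> (path_join (\<lambda>_. vertex v) (path_reverse \<sigma>))"
  have inner: "pathin ?R (path_join q (\<lambda>_. y))" "pathin ?R (path_join (\<lambda>_. vertex v) (path_reverse \<sigma>))"
    using pq const_paths \<sigma> by (auto intro!: pathin_join simp: pathin_path_reverse)
  have "homotopic_paths_in ?R ?L (path_join q (\<lambda>_. y))"
    using inner(1) pq by (intro homotopic_paths_in_lid) auto
  also have "homotopic_paths_in ?R (path_join q (\<lambda>_. y)) q"
    using pq by (intro homotopic_paths_in_rid) auto
  finally have L: "homotopic_paths_in ?R ?L q" .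
  have "homotopic_paths_in ?R ?M (path_join \<sigma> (path_reverse \<sigma>))"
    using \<sigma> by (intro homotopic_paths_in_join homotopic_paths_in_lid)
      (auto simp: pathin_path_reverse homotopic_paths_in_refl)
  also have "homotopic_paths_in ?R (path_join \<sigma> (path_reverse \<sigma>)) (\<lambda>_. y)"
    using \<sigma> by (intro homotopic_paths_in_rinv) auto
  finally have M: "homotopic_paths_in ?R ?M (\<lambda>_. y)" .
  have "homotopic_paths_in ?R ?L ?M"
  proof (rule homotopic_paths_in_realization[OF K])
    show L': "pathin ?R ?L" and "pathin ?R ?M"
      using L M homotopic_paths_in_imp_pathin by blast+
    fix r :: real assume r: "r \<in> {0..1}"
    have "{w. ?M r w \<noteq> 0} \<subseteq> {w. ?L r w \<noteq> 0}"
    proof (cases "1/2 < r \<and> r \<le> 3/4")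
      case True
      then have "?M r = vertex v" "?L r = q (2 * (2 * r - 1))"
        by (auto simp: path_join_def)
      then show ?thesis
        using star[of "2 * (2 * r - 1)"] True by (auto simp: vertex_def)
    next
      case False
      then have "?L r = y" "?M r \<in> range \<sigma>"
        by (auto simp: path_join_def path_reverse_def)
      then obtain s where "?L r = y" "?M r = \<sigma> s" by blast
      then show ?thesis using \<sigma>(4)[of s] by simp
    qed
    moreover have "?L r \<in> realization_set K"
      using path_image_subset_topspace[OF L'] r by auto
    ultimately show "{w. ?L r w \<noteq> 0} \<union> {w. ?M r w \<noteq> 0} \<in> K"
      by (simp add: Un_absorb2 realization_set_def)
  qed (use \<sigma> pq in auto)
  then show ?thesis
    using L M homotopic_paths_in_sym homotopic_paths_in_trans by blast
qed

section \<open>Generators of Spanier groups and their images in the nerve\<close>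

definition spanier_generators :: "'a topology \<Rightarrow> 'a set set \<Rightarrow> 'a \<Rightarrow> (real \<Rightarrow> 'a) set set" where
  "spanier_generators X \<U> x0 =
     {path_class X (path_join (path_join \<alpha> \<gamma>) (path_reverse \<alpha>)) | \<alpha> \<gamma>.
        pathin X \<alpha> \<and> \<alpha> 0 = x0 \<and> loop_at X (\<alpha> 1) \<gamma> \<and> (\<exists>U\<in>\<U>. \<gamma> ` {0..1} \<subseteq> U)}"

lemma spanier_group_eq_generate:
  "spanier_group X \<U> x0 = generate (fundamental_group X x0) (spanier_generators X \<U> x0)"
  by (simp add: spanier_group_def spanier_generators_def)

lemma conjugate_path_loop_at:
  assumes "pathin X \<alpha>" "loop_at X (\<alpha> 1) \<gamma>"
  shows "loop_at X (\<alpha> 0) (path_join (path_join \<alpha> \<gamma>) (path_reverse \<alpha>))"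
  using assms by (auto simp: loop_at_def intro!: pathin_join pathin_path_reverse)

lemma spanier_generators_carrier: "spanier_generators X \<U> x0 \<subseteq> carrier (fundamental_group X x0)"
  unfolding spanier_generators_def using conjugate_path_loop_at path_class_in_carrier by fastforce

lemma conjugate_null_homotopic:
  assumes "pathin X \<alpha>" "homotopic_paths_in X \<gamma> (\<lambda>_. \<alpha> 1)"
  shows "homotopic_paths_in X (path_join (path_join \<alpha> \<gamma>) (path_reverse \<alpha>)) (\<lambda>_. \<alpha> 0)"
proof -
  have ends: "\<gamma> 0 = \<alpha> 1" "\<gamma> 1 = \<alpha> 1"
    using homotopic_paths_in_imp_ends[OF assms(2)] by auto
  have "homotopic_paths_in X (path_join \<alpha> \<gamma>) (path_join \<alpha> (\<lambda>_. \<alpha> 1))"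
    using assms ends by (intro homotopic_paths_in_join) (auto simp: homotopic_paths_in_refl)
  also have "homotopic_paths_in X (path_join \<alpha> (\<lambda>_. \<alpha> 1)) \<alpha>"
    using assms by (intro homotopic_paths_in_rid) auto
  finally have "homotopic_paths_in X (path_join (path_join \<alpha> \<gamma>) (path_reverse \<alpha>)) (path_join \<alpha> (path_reverse \<alpha>))"
    using assms ends by (intro homotopic_paths_in_join) (auto simp: homotopic_paths_in_refl pathin_path_reverse)
  also have "homotopic_paths_in X (path_join \<alpha> (path_reverse \<alpha>)) (\<lambda>_. \<alpha> 0)"
    using assms by (intro homotopic_paths_in_rinv) auto
  finally show ?thesis .
qed

text \<open>The kernel is a subgroup, so generators suffice: \<open>p\<close> sends
  \<open>\<gamma>\<close> into the open star of a single vertex, where it is null homotopic, and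
  conjugating by a path preserves this.\<close>

lemma spanier_group_in_kernel:
  assumes x0: "x0 \<in> topspace X" and p: "canonical_map X x0 u p"
    and star: "\<And>W. W \<in> \<W> \<Longrightarrow> \<exists>U\<in>fst u. \<forall>x\<in>W. p x U \<noteq> 0"
    and A: "A \<in> spanier_group X \<W> x0"
  shows "induced_map (nerve_space u) p A = \<one>\<^bsub>nerve_group u\<^esub>"
proof -
  let ?G = "fundamental_group X x0"
  have cont: "continuous_map X (nerve_space u) p" and px0: "p x0 = vertex (snd u)"
    using p by (auto simp: canonical_map_def)
  have v: "vertex (snd u) \<in> topspace (nerve_space u)"
    using cont x0 px0 by (metis continuous_map_image_subset_topspace image_subset_iff Pi_iff)
  interpret G: group ?G using x0 by (rule group_fundamental_group)
  interpret N: group "nerve_group u"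
    unfolding nerve_group_def using v by (rule group_fundamental_group)
  interpret h: group_hom ?G "nerve_group u" "induced_map (nerve_space u) p"
    using induced_map_hom[OF cont, of x0] px0
    by unfold_locales (simp add: nerve_group_def)
  have "spanier_generators X \<W> x0 \<subseteq> kernel ?G (nerve_group u) (induced_map (nerve_space u) p)"
  proof
    fix B assume B: "B \<in> spanier_generators X \<W> x0"
    then obtain \<alpha> \<gamma> W where B_eq: "B = path_class X (path_join (path_join \<alpha> \<gamma>) (path_reverse \<alpha>))"
      and \<alpha>: "pathin X \<alpha>" "\<alpha> 0 = x0" and \<gamma>: "loop_at X (\<alpha> 1) \<gamma>" and W: "W \<in> \<W>" "\<gamma> ` {0..1} \<subseteq> W"
      unfolding spanier_generators_def by blast
    obtain U where U: "U \<in> fst u" "\<And>x. x \<in> W \<Longrightarrow> p x U \<noteq> 0"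
      using star[OF W(1)] by blast
    have pU: "(p \<circ> \<gamma>) r U \<noteq> 0" if "r \<in> {0..1}" for r
      using U(2) W(2) that by (simp add: image_subset_iff)
    \<comment> \<open>A point of the loop shows that \<open>U\<close> is nonempty and therefore a
      vertex of the nerve.\<close>
    have "\<gamma> 0 \<in> topspace X" using \<gamma> path_start_in_topspace unfolding loop_at_def by metis
    then have "\<gamma> 0 \<in> U"
      using canonical_map_support(3)[OF p] pU[of 0] by auto
    then have "{U} \<in> nerve (fst u)"
      using U(1) by (auto simp: nerve_def)
    moreover have "loop_at (realization (nerve (fst u))) (p (\<alpha> 1)) (p \<circ> \<gamma>)"
      using loop_at_compose[OF cont \<gamma>] by (simp add: nerve_space_def)
    ultimately have null: "homotopic_paths_in (nerve_space u) (p \<circ> \<gamma>) (\<lambda>_. (p \<circ> \<alpha>) 1)"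
      unfolding nerve_space_def o_apply[of p \<alpha>] using nerve_finite pU
      by (intro loop_in_open_star_null_homotopic[of "nerve (fst u)" U])
    have "homotopic_paths_in (nerve_space u)
        (path_join (path_join (p \<circ> \<alpha>) (p \<circ> \<gamma>)) (path_reverse (p \<circ> \<alpha>))) (\<lambda>_. (p \<circ> \<alpha>) 0)"
      using pathin_compose[OF \<alpha>(1) cont] null by (rule conjugate_null_homotopic)
    then have "homotopic_paths_in (nerve_space u)
        (p \<circ> path_join (path_join \<alpha> \<gamma>) (path_reverse \<alpha>)) (\<lambda>_. vertex (snd u))"
      using \<alpha>(2) px0 by (simp add: path_join_compose path_reverse_compose)
    then have "induced_map (nerve_space u) p B = \<one>\<^bsub>nerve_group u\<^esub>"
      using conjugate_path_loop_at[OF \<alpha>(1) \<gamma>] unfolding B_eq nerve_group_def fundamental_group_one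
      by (simp add: induced_map_path_class[OF cont] loop_at_def path_class_cong)
    then show "B \<in> kernel ?G (nerve_group u) (induced_map (nerve_space u) p)"
      using subsetD[OF spanier_generators_carrier B] by (simp add: kernel_def)
  qed
  then have "spanier_group X \<W> x0 \<subseteq> kernel ?G (nerve_group u) (induced_map (nerve_space u) p)"
    unfolding spanier_group_eq_generate using h.subgroup_kernel by (intro G.generate_subgroup_incl)
  then show ?thesis
    using A by (auto simp: kernel_def)
qed

section \<open>A path cocycle with values in the quotient by a Spanier group\<close>

text \<open>This is an equality of functions. Reversal exchanges the two halves; only at time 1/2 do
  the sides use different branches, and there the hypothesis makes them agree.\<close>

lemma path_reverse_join:
  assumes "p 1 = q 0"
  shows "path_reverse (path_join p q) = path_join (path_reverse q) (path_reverse p)"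
proof
  fix t :: real
  consider "t < 1/2" | "t = 1/2" | "1/2 < t" by linarith
  then show "path_reverse (path_join p q) t = path_join (path_reverse q) (path_reverse p) t"
  proof cases
    case 1
    then have "2 * (1 - t) - 1 = 1 - 2 * t" by simp
    then show ?thesis using 1 by (simp add: path_reverse_def path_join_def)
  next
    case 2
    show ?thesis unfolding 2 by (simp add: path_reverse_def path_join_def assms)
  next
    case 3
    then have "2 * (1 - t) = 1 - (2 * t - 1)" by simp
    then show ?thesis using 3 by (simp add: path_reverse_def path_join_def)
  qed
qed

text \<open>Conjugating the generator of \<open>\<alpha>\<close> and \<open>\<gamma>\<close> by a
  loop \<open>\<delta>\<close> gives, up to homotopy, the generator of
  \<open>path_join \<delta> \<alpha>\<close> and the same \<open>\<gamma>\<close>, so the generating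
  set is closed under conjugation.\<close>

lemma spanier_group_normal:
  assumes x0: "x0 \<in> topspace X"
  shows "spanier_group X \<U> x0 \<lhd> fundamental_group X x0"
proof -
  interpret group "fundamental_group X x0" using x0 by (rule group_fundamental_group)
  show ?thesis
    unfolding spanier_group_eq_generate
  proof (rule normal_generateI[OF spanier_generators_carrier])
    fix A B assume "A \<in> spanier_generators X \<U> x0" "B \<in> carrier (fundamental_group X x0)"
    then obtain \<alpha> \<gamma> U \<delta> where A: "A = path_class X (path_join (path_join \<alpha> \<gamma>) (path_reverse \<alpha>))"
      and \<alpha>: "pathin X \<alpha>" "\<alpha> 0 = x0" and \<gamma>: "loop_at X (\<alpha> 1) \<gamma>" and U: "U \<in> \<U>" "\<gamma> ` {0..1} \<subseteq> U"
      and \<delta>: "loop_at X x0 \<delta>" "B = path_class X \<delta>"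
      unfolding spanier_generators_def fundamental_group_carrier by blast
    have g: "pathin X \<gamma>" "\<gamma> 0 = \<alpha> 1" "\<gamma> 1 = \<alpha> 1" and d: "pathin X \<delta>" "\<delta> 0 = x0" "\<delta> 1 = x0"
      using \<gamma> \<delta>(1) by (auto simp: loop_at_def)
    let ?r = path_reverse
    note simps = pathin_join pathin_path_reverse \<alpha> g d homotopic_paths_in_refl
    have "homotopic_paths_in X (path_join (path_join \<delta> (path_join (path_join \<alpha> \<gamma>) (?r \<alpha>))) (?r \<delta>))
        (path_join (path_join (path_join \<delta> (path_join \<alpha> \<gamma>)) (?r \<alpha>)) (?r \<delta>))"
      by (rule homotopic_paths_in_join[OF homotopic_paths_in_sym[OF homotopic_paths_in_assoc]])
         (simp_all add: simps)
    also have "homotopic_paths_in X \<dots> (path_join (path_join \<delta> (path_join \<alpha> \<gamma>)) (path_join (?r \<alpha>) (?r \<delta>)))"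
      by (rule homotopic_paths_in_assoc) (simp_all add: simps)
    also have "homotopic_paths_in X \<dots> (path_join (path_join (path_join \<delta> \<alpha>) \<gamma>) (path_join (?r \<alpha>) (?r \<delta>)))"
      by (rule homotopic_paths_in_join[OF homotopic_paths_in_sym[OF homotopic_paths_in_assoc]])
         (simp_all add: simps)
    also have "path_join (?r \<alpha>) (?r \<delta>) = ?r (path_join \<delta> \<alpha>)"
      by (simp add: path_reverse_join \<alpha> d)
    finally have hom: "homotopic_paths_in X (path_join (path_join \<delta> (path_join (path_join \<alpha> \<gamma>) (?r \<alpha>))) (?r \<delta>))
        (path_join (path_join (path_join \<delta> \<alpha>) \<gamma>) (?r (path_join \<delta> \<alpha>)))" .
    have "B \<otimes>\<^bsub>fundamental_group X x0\<^esub> A \<otimes>\<^bsub>fundamental_group X x0\<^esub> inv\<^bsub>fundamental_group X x0\<^esub> B =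
        path_class X (path_join (path_join \<delta> (path_join (path_join \<alpha> \<gamma>) (?r \<alpha>))) (?r \<delta>))"
      unfolding A \<delta>(2) fundamental_group_inv[OF \<delta>(1)]
      by (simp add: fundamental_group_mult simps)
    also have "\<dots> = path_class X (path_join (path_join (path_join \<delta> \<alpha>) \<gamma>) (?r (path_join \<delta> \<alpha>)))"
      by (rule path_class_cong[OF hom])
    also have "\<dots> \<in> spanier_generators X \<U> x0"
      unfolding spanier_generators_def
      using U \<gamma> by (intro CollectI exI[of _ "path_join \<delta> \<alpha>"] exI[of _ \<gamma>]) (auto simp: simps)
    finally show "B \<otimes>\<^bsub>fundamental_group X x0\<^esub> A \<otimes>\<^bsub>fundamental_group X x0\<^esub> inv\<^bsub>fundamental_group X x0\<^esub> B
        \<in> spanier_generators X \<U> x0" .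
  qed
qed

text \<open>Closing up each path with chosen paths from the basepoint turns concatenation of paths into
  multiplication in the quotient of the fundamental group.\<close>

lemma spanier_cocycle_exists:
  assumes "path_connected_space X" "x0 \<in> topspace X"
  obtains Q :: "(real \<Rightarrow> 'a) set set monoid" and c :: "(real \<Rightarrow> 'a) \<Rightarrow> (real \<Rightarrow> 'a) set set"
  where "group Q" "\<And>p. pathin X p \<Longrightarrow> c p \<in> carrier Q"
    "\<And>p q. pathin X p \<Longrightarrow> pathin X q \<Longrightarrow> p 1 = q 0 \<Longrightarrow> c (path_join p q) = c p \<otimes>\<^bsub>Q\<^esub> c q"
    "\<And>p q. homotopic_paths_in X p q \<Longrightarrow> c p = c q"
    "\<And>y \<gamma> U. loop_at X y \<gamma> \<Longrightarrow> U \<in> \<U> \<Longrightarrow> \<gamma> ` {0..1} \<subseteq> U \<Longrightarrow> c \<gamma> = \<one>\<^bsub>Q\<^esub>"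
    "\<And>\<alpha>. loop_at X x0 \<alpha> \<Longrightarrow> c \<alpha> = \<one>\<^bsub>Q\<^esub> \<Longrightarrow> path_class X \<alpha> \<in> spanier_group X \<U> x0"
proof -
  let ?G = "fundamental_group X x0"
  let ?N = "spanier_group X \<U> x0"
  interpret G: group ?G using assms(2) by (rule group_fundamental_group)
  interpret N: normal ?N ?G using assms(2) by (rule spanier_group_normal)
  \<comment> \<open>Prescribing the constant path at \<open>x0\<close> ensures that closing up a
    loop at \<open>x0\<close> changes it only by constant paths.\<close>
  have "\<exists>l. pathin X l \<and> l 0 = x0 \<and> l 1 = y \<and> (y = x0 \<longrightarrow> l = (\<lambda>_. x0))" if "y \<in> topspace X" for y
  proof (cases "y = x0")
    case True
    then show ?thesis using assms(2) by (intro exI[of _ "\<lambda>_. x0"]) (simp add: pathin_const)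
  next
    case False
    then show ?thesis using assms that unfolding path_connected_space_def by metis
  qed
  then obtain l where l: "\<And>y. y \<in> topspace X \<Longrightarrow> pathin X (l y)" "\<And>y. y \<in> topspace X \<Longrightarrow> l y 0 = x0"
    "\<And>y. y \<in> topspace X \<Longrightarrow> l y 1 = y" "l x0 = (\<lambda>_. x0)"
    using assms(2) by metis
  define w where "w p = path_join (path_join (l (p 0)) p) (path_reverse (l (p 1)))" for p
  define c where "c p = ?N #>\<^bsub>?G\<^esub> path_class X (w p)" for p
  have ends: "p 0 \<in> topspace X" "p 1 \<in> topspace X" if "pathin X p" for p
    using path_start_in_topspace[OF that] path_finish_in_topspace[OF that] by auto
  have w: "loop_at X x0 (w p)" if "pathin X p" for p
    using that l ends[OF that] unfolding w_def loop_at_def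
    by (auto intro!: pathin_join pathin_path_reverse)
  have w_hom: "homotopic_paths_in X (w p) (w q)" if "homotopic_paths_in X p q" for p q
  proof -
    have pq: "pathin X p" "q 0 = p 0" "q 1 = p 1"
      using that homotopic_paths_in_imp_pathin homotopic_paths_in_imp_ends by metis+
    show ?thesis
      unfolding w_def pq(2,3) using that l ends[OF pq(1)]
      by (intro homotopic_paths_in_join) (auto simp: homotopic_paths_in_refl pathin_path_reverse)
  qed
  \<comment> \<open>The two closing paths at the junction are inverse to each other and
    cancel.\<close>
  have w_join: "homotopic_paths_in X (path_join (w p) (w q)) (w (path_join p q))"
    if p: "pathin X p" and q: "pathin X q" and pq: "p 1 = q 0" for p q
  proof -
    let ?a = "path_join (l (p 0)) p" and ?m = "l (q 0)" and ?e = "path_reverse (l (q 1))"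
    note simps = pathin_join pathin_path_reverse p q pq l ends[OF p] ends[OF q] homotopic_paths_in_refl
    have q0: "q 0 \<in> topspace X" using ends q by blast
    have "homotopic_paths_in X (path_join (path_join ?a (path_reverse ?m)) (path_join ?m q))
        (path_join ?a (path_join (path_reverse ?m) (path_join ?m q)))"
      by (rule homotopic_paths_in_assoc) (simp_all add: simps q0)
    also have "homotopic_paths_in X \<dots> (path_join ?a (path_join (path_join (path_reverse ?m) ?m) q))"
      by (intro homotopic_paths_in_join homotopic_paths_in_sym[OF homotopic_paths_in_assoc])
         (simp_all add: simps q0)
    also have "homotopic_paths_in X \<dots> (path_join ?a (path_join (\<lambda>_. q 0) q))"
      by (intro homotopic_paths_in_join homotopic_paths_in_linv) (simp_all add: simps q0)
    also have "homotopic_paths_in X \<dots> (path_join ?a q)"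
      by (intro homotopic_paths_in_join homotopic_paths_in_lid) (simp_all add: simps q0)
    also have "homotopic_paths_in X \<dots> (path_join (l (p 0)) (path_join p q))"
      by (rule homotopic_paths_in_assoc) (simp_all add: simps)
    finally have 1: "homotopic_paths_in X (path_join (path_join ?a (path_reverse ?m)) (path_join ?m q))
        (path_join (l (p 0)) (path_join p q))" .
    have "homotopic_paths_in X (path_join (path_join ?a (path_reverse ?m)) (path_join (path_join ?m q) ?e))
        (path_join (path_join (path_join ?a (path_reverse ?m)) (path_join ?m q)) ?e)"
      by (rule homotopic_paths_in_sym[OF homotopic_paths_in_assoc]) (simp_all add: simps q0)
    also have "homotopic_paths_in X \<dots> (path_join (path_join (l (p 0)) (path_join p q)) ?e)"
      using 1 by (rule homotopic_paths_in_join) (simp_all add: simps)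
    finally show ?thesis
      using pq by (simp add: w_def)
  qed
  have carr: "path_class X (w p) \<in> carrier ?G" if "pathin X p" for p
    using w[OF that] by (rule path_class_in_carrier)
  show ?thesis
  proof
    show "group (?G Mod ?N)" by (rule N.factorgroup_is_group)
    show "c p \<in> carrier (?G Mod ?N)" if "pathin X p" for p
      using carr[OF that] unfolding c_def by (auto simp: FactGroup_def RCOSETS_def)
    show "c (path_join p q) = c p \<otimes>\<^bsub>?G Mod ?N\<^esub> c q" if "pathin X p" "pathin X q" "p 1 = q 0" for p q
    proof -
      have "path_class X (w (path_join p q)) = path_class X (w p) \<otimes>\<^bsub>?G\<^esub> path_class X (w q)"
        using w[OF that(1)] w[OF that(2)] path_class_cong[OF w_join[OF that]]
        by (simp add: fundamental_group_mult loop_at_def)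
      then show ?thesis
        unfolding c_def using hom_mult[OF N.r_coset_hom_Mod carr[OF that(1)] carr[OF that(2)]] by simp
    qed
    show "c p = c q" if "homotopic_paths_in X p q" for p q
      unfolding c_def using path_class_cong[OF w_hom[OF that]] by simp
    show "c \<gamma> = \<one>\<^bsub>?G Mod ?N\<^esub>" if "loop_at X y \<gamma>" "U \<in> \<U>" "\<gamma> ` {0..1} \<subseteq> U" for y \<gamma> U
    proof -
      have \<gamma>: "pathin X \<gamma>" "\<gamma> 0 = y" "\<gamma> 1 = y" using that(1) by (auto simp: loop_at_def)
      have y: "y \<in> topspace X" using ends[OF \<gamma>(1)] \<gamma>(2) by simp
      \<comment> \<open>A loop at \<open>y\<close> is closed up by the same path on both sides,
        which is literally the shape of a Spanier generator.\<close>
      have "path_class X (w \<gamma>) \<in> spanier_generators X \<U> x0"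
        unfolding spanier_generators_def w_def \<gamma> using that l(1-3)[OF y]
        by (intro CollectI exI[of _ "l y"] exI[of _ \<gamma>]) auto
      then have "path_class X (w \<gamma>) \<in> ?N"
        unfolding spanier_group_eq_generate by (rule generate.incl)
      then have "c \<gamma> = ?N"
        unfolding c_def using carr[OF \<gamma>(1)] N.is_subgroup by (intro G.coset_join2)
      then show ?thesis by (simp add: FactGroup_def)
    qed
    show "path_class X \<alpha> \<in> ?N" if "loop_at X x0 \<alpha>" "c \<alpha> = \<one>\<^bsub>?G Mod ?N\<^esub>" for \<alpha>
    proof -
      have \<alpha>: "pathin X \<alpha>" "\<alpha> 0 = x0" "\<alpha> 1 = x0" using that(1) by (auto simp: loop_at_def)
      have "path_class X (w \<alpha>) \<in> ?N #>\<^bsub>?G\<^esub> path_class X (w \<alpha>)"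
        using carr[OF \<alpha>(1)] N.is_subgroup by (intro G.rcos_self)
      then have "path_class X (w \<alpha>) \<in> ?N"
        using that(2) by (simp add: c_def FactGroup_def)
      moreover have "homotopic_paths_in X (w \<alpha>) \<alpha>"
      proof -
        have "path_reverse (\<lambda>_. x0) = (\<lambda>_. x0)" by (simp add: path_reverse_def)
        then have "w \<alpha> = path_join (path_join (\<lambda>_. x0) \<alpha>) (\<lambda>_. x0)"
          by (simp add: w_def \<alpha> l(4))
        moreover have "homotopic_paths_in X \<dots> (path_join (\<lambda>_. x0) \<alpha>)"
          using \<alpha> assms(2) by (intro homotopic_paths_in_rid pathin_join) (auto simp: pathin_const)
        moreover have "homotopic_paths_in X (path_join (\<lambda>_. x0) \<alpha>) \<alpha>"
          using \<alpha> by (intro homotopic_paths_in_lid) auto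
        ultimately show ?thesis using homotopic_paths_in_trans by metis
      qed
      ultimately show ?thesis by (simp add: path_class_cong)
    qed
  qed
qed

section \<open>The kernel of a canonical map\<close>

definition subpath_in :: "(real \<Rightarrow> 'a) \<Rightarrow> real \<Rightarrow> real \<Rightarrow> real \<Rightarrow> 'a" where
  "subpath_in p u v = (\<lambda>t. p (u + (v - u) * t))"

lemma subpath_in_ends [simp]: "subpath_in p u v 0 = p u" "subpath_in p u v 1 = p v"
  by (simp_all add: subpath_in_def)

lemma affine_image_unit_interval:
  fixes u v :: real
  assumes "u \<le> v"
  shows "(\<lambda>t. u + (v - u) * t) ` {0..1} \<subseteq> {u..v}"
proof clarsimp
  fix t :: real assume t: "0 \<le> t" "t \<le> 1"
  then have "(v - u) * t \<le> (v - u) * 1" using assms by (intro mult_left_mono) auto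
  then show "0 \<le> (v - u) * t \<and> u + (v - u) * t \<le> v" using t assms by simp
qed

lemma subpath_in_image: "u \<le> v \<Longrightarrow> subpath_in p u v ` {0..1} \<subseteq> p ` {u..v}"
  using affine_image_unit_interval[of u v] by (auto simp: subpath_in_def)

lemma pathin_subpath_in:
  assumes "pathin X p" "0 \<le> u" "u \<le> v" "v \<le> 1"
  shows "pathin X (subpath_in p u v)"
proof -
  have "(\<lambda>t. u + (v - u) * t) ` {0..1} \<subseteq> {0..1}"
    using affine_image_unit_interval[OF assms(3)] assms(2,4) by fastforce
  then have "pathin X (p \<circ> (\<lambda>t. u + (v - u) * t))"
    using assms(1) by (intro pathin_reparam continuous_intros)
  then show ?thesis by (simp add: subpath_in_def o_def)
qed

lemma homotopic_join_subpaths_in: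
  assumes p: "pathin X p" and uvw: "0 \<le> u" "u \<le> v" "v \<le> w" "w \<le> 1"
  shows "homotopic_paths_in X (path_join (subpath_in p u v) (subpath_in p v w)) (subpath_in p u w)"
proof -
  let ?f = "\<lambda>t. u + (v - u) * t" and ?g = "\<lambda>t. v + (w - v) * t" and ?k = "\<lambda>t. u + (w - u) * t"
  have eq: "path_join (subpath_in p u v) (subpath_in p v w) = p \<circ> path_join ?f ?g"
    "subpath_in p u w = p \<circ> ?k"
    by (auto simp: subpath_in_def path_join_def)
  have im: "?f ` {0..1} \<subseteq> {0..1}" "?g ` {0..1} \<subseteq> {0..1}" "?k ` {0..1} \<subseteq> {0..1}"
    using affine_image_unit_interval[of u v] affine_image_unit_interval[of v w]
      affine_image_unit_interval[of u w] uvw by fastforce+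
  \<comment> \<open>Treating the affine parameters as paths in the real line makes the continuity of
    their concatenation a case of \<open>pathin_join\<close>.\<close>
  have "pathin euclideanreal ?f" "pathin euclideanreal ?g"
    unfolding pathin_def by (simp_all add: continuous_intros)
  then have "pathin euclideanreal (path_join ?f ?g)"
    by (rule pathin_join) simp
  then have "continuous_on {0..1} (path_join ?f ?g)"
    by (simp add: pathin_def)
  then show ?thesis
    unfolding eq
    using im by (intro homotopic_paths_in_reparam[OF p] path_join_image) (auto intro!: continuous_intros)
qed

text \<open>The factors keep their order, since the quotient of a fundamental group need not be
  commutative.\<close>

primrec partial_prod :: "('b, 'm) monoid_scheme \<Rightarrow> (nat \<Rightarrow> 'b) \<Rightarrow> nat \<Rightarrow> 'b" where
  "partial_prod G a 0 = \<one>\<^bsub>G\<^esub>"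
| "partial_prod G a (Suc k) = partial_prod G a k \<otimes>\<^bsub>G\<^esub> a k"

lemma (in group) partial_prod_closed:
  "(\<And>i. i < k \<Longrightarrow> a i \<in> carrier G) \<Longrightarrow> partial_prod G a k \<in> carrier G"
  by (induction k) auto

lemma (in group) partial_prod_one:
  "(\<And>i. i < k \<Longrightarrow> a i = \<one>) \<Longrightarrow> partial_prod G a k = \<one>"
  by (induction k) auto

text \<open>Pasting of squares: \<open>a i\<close> and \<open>a' i\<close> are the two horizontal
  edges of the square number \<open>i\<close> and \<open>b i\<close>, \<open>b (Suc i)\<close> its
  vertical ones. Interior vertical edges are passed from one square to the next, so only the outer
  two remain.\<close>

lemma (in group) partial_prod_commuting_squares:
  assumes "\<And>i. i < k \<Longrightarrow> a i \<in> carrier G" "\<And>i. i < k \<Longrightarrow> a' i \<in> carrier G" "\<And>i. i \<le> k \<Longrightarrow> b i \<in> carrier G"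
    and "\<And>i. i < k \<Longrightarrow> a i \<otimes> b (Suc i) = b i \<otimes> a' i"
  shows "partial_prod G a k \<otimes> b k = b 0 \<otimes> partial_prod G a' k"
  using assms
proof (induction k)
  case (Suc k)
  have carr: "partial_prod G a k \<in> carrier G" "partial_prod G a' k \<in> carrier G"
    using Suc.prems by (auto intro: partial_prod_closed)
  have mem: "a k \<in> carrier G" "a' k \<in> carrier G" "b k \<in> carrier G" "b (Suc k) \<in> carrier G" "b 0 \<in> carrier G"
    using Suc.prems(1-3) by auto
  have "partial_prod G a (Suc k) \<otimes> b (Suc k) = partial_prod G a k \<otimes> (b k \<otimes> a' k)"
    using carr mem Suc.prems(4)[of k] by (simp add: m_assoc)
  also have "\<dots> = (partial_prod G a k \<otimes> b k) \<otimes> a' k"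
    using carr mem by (simp add: m_assoc)
  also have "partial_prod G a k \<otimes> b k = b 0 \<otimes> partial_prod G a' k"
    using Suc.prems by (intro Suc.IH) auto
  finally show ?case
    using carr mem by (simp add: m_assoc)
qed auto

lemma grid_interval:
  assumes "i < n" "s \<in> {real i / real n..real (Suc i) / real n}"
  shows "s \<in> {0..1}" "\<bar>s - real i / real n\<bar> \<le> 1 / real n"
proof -
  have "real (Suc i) / real n \<le> 1" "0 \<le> real i / real n"
    using assms(1) by (simp_all add: divide_le_eq)
  then show "s \<in> {0..1}"
    using assms(2) by (meson atLeastAtMost_iff order_trans)
  show "\<bar>s - real i / real n\<bar> \<le> 1 / real n"
    using assms(2) by (auto simp: add_divide_distrib)
qed

text \<open>\<open>L i j\<close> is a vertex of the nerve whose open star contains the null homotopy near the node with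
  path parameter \<open>i/n\<close> and homotopy parameter \<open>j/n\<close>. The image of that node lies in the open stars of
  all neighbouring labels, so these span a simplex.\<close>

lemma null_homotopy_grid_labelling:
  assumes x0: "x0 \<in> topspace X"
    and p: "canonical_map X x0 (\<V>, V0) p" and \<alpha>: "loop_at X x0 \<alpha>"
    and null: "homotopic_paths_in (nerve_space (\<V>, V0)) (p \<circ> \<alpha>) (\<lambda>_. vertex V0)"
  obtains n L where "0 < n" "\<And>i j. i \<le> n \<Longrightarrow> j \<le> n \<Longrightarrow> L i j \<in> \<V>"
    "\<And>i j. i \<le> n \<Longrightarrow> j \<le> n \<Longrightarrow> i = 0 \<or> i = n \<or> j = n \<Longrightarrow> L i j = V0"
    "\<And>i s. i \<le> n \<Longrightarrow> s \<in> {0..1} \<Longrightarrow> \<bar>s - real i / real n\<bar> \<le> 1 / real n \<Longrightarrow> \<alpha> s \<in> L i 0"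
    "\<And>i j. i \<le> n \<Longrightarrow> j \<le> n \<Longrightarrow>
      \<exists>y. \<forall>i'\<in>{i, Suc i}. \<forall>j'\<in>{j, Suc j}. i' \<le> n \<longrightarrow> j' \<le> n \<longrightarrow> y \<in> L i' j'"
proof -
  let ?K = "nerve \<V>" and ?I2 = "{0..1::real} \<times> {0..1::real}"
  obtain h where h: "path_homotopy (realization ?K) h (p \<circ> \<alpha>) (\<lambda>_. vertex V0)"
    using null unfolding nerve_space_def fst_conv homotopic_paths_in_iff by blast
  have hcont: "continuous_map (top_of_set ?I2) (realization ?K) h"
    using h by (simp add: path_homotopy_def)
  have h0: "h (0, t) = p (\<alpha> t)" "h (1, t) = vertex V0" if "t \<in> {0..1}" for t
    using h that by (auto simp: path_homotopy_def)
  have hside: "h (s, 0) = vertex V0" "h (s, 1) = vertex V0" if "s \<in> {0..1}" for s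
    using h that p \<alpha> by (auto simp: path_homotopy_def canonical_map_def loop_at_def)
  have hreal: "h z \<in> realization_set ?K" if "z \<in> ?I2" for z
    using hcont that by (auto simp: continuous_map_def)
  \<comment> \<open>Pulled back open stars, extended to open sets of the plane so that the compact
    square has a Lebesgue number \<epsilon> for them.\<close>
  define \<B> where "\<B> = {B. open B \<and> (\<exists>V. \<forall>z\<in>B \<inter> ?I2. h z V \<noteq> 0)}"
  have "?I2 \<subseteq> \<Union>\<B>"
  proof
    fix z assume z: "z \<in> ?I2"
    then have "{V. h z V \<noteq> 0} \<in> ?K"
      using hreal by (simp add: realization_set_def)
    then obtain V where V: "h z V \<noteq> 0"
      by (auto simp: nerve_def)
    have "openin (top_of_set ?I2) {w \<in> topspace (top_of_set ?I2). h w \<in> open_star ?K V}"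
      by (rule openin_continuous_map_preimage[OF hcont openin_open_star])
    then obtain B' where B': "open B'" "{w \<in> ?I2. h w \<in> open_star ?K V} = ?I2 \<inter> B'"
      by (auto simp: openin_open)
    have "z \<in> {w \<in> ?I2. h w \<in> open_star ?K V}"
      using z V hreal by (simp add: open_star_def)
    moreover have "h w V \<noteq> 0" if "w \<in> B' \<inter> ?I2" for w
    proof -
      have "w \<in> {w \<in> ?I2. h w \<in> open_star ?K V}" using that unfolding B'(2) by blast
      then show ?thesis by (simp add: open_star_def)
    qed
    ultimately show "z \<in> \<Union>\<B>"
      using B' unfolding \<B>_def by blast
  qed
  moreover have "compact ?I2" by (intro compact_Times) auto
  ultimately obtain \<epsilon> where \<epsilon>: "0 < \<epsilon>" "\<And>z. z \<in> ?I2 \<Longrightarrow> \<exists>B\<in>\<B>. ball z \<epsilon> \<subseteq> B"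
    using Heine_Borel_lemma[of ?I2 \<B>] unfolding \<B>_def by blast
  \<comment> \<open>Neighbouring nodes differ by at most \<open>1 / real n\<close> in each
    coordinate, hence by at most \<open>2 / real n\<close> in distance, which must stay below
    \<epsilon>.\<close>
  obtain m where m: "2 / \<epsilon> < real m" using reals_Archimedean2 by blast
  define n where "n = Suc m"
  have n: "0 < n" "2 / real n < \<epsilon>"
  proof -
    have "2 / \<epsilon> < real n" using m by (simp add: n_def)
    then show "2 / real n < \<epsilon>" using \<epsilon>(1) by (simp add: n_def field_simps)
  qed (simp add: n_def)
  \<comment> \<open>The homotopy takes its own parameter first and the path parameter second, so the
    indices appear exchanged.\<close>
  define node where "node i j = (real j / real n, real i / real n)" for i j
  have node: "node i j \<in> ?I2" if "i \<le> n" "j \<le> n" for i j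
    using that n by (simp add: node_def)
  have "\<exists>V. \<forall>z\<in>?I2. dist (node i j) z < \<epsilon> \<longrightarrow> h z V \<noteq> 0" if "i \<le> n" "j \<le> n" for i j
  proof -
    obtain B' where "B' \<in> \<B>" "ball (node i j) \<epsilon> \<subseteq> B'"
      by (rule bexE[OF \<epsilon>(2)[OF node[OF \<open>i \<le> n\<close> \<open>j \<le> n\<close>]]])
    then obtain V where "\<forall>z\<in>B' \<inter> ?I2. h z V \<noteq> 0"
      unfolding \<B>_def by blast
    then show ?thesis
      using \<open>ball (node i j) \<epsilon> \<subseteq> B'\<close> by (meson IntI mem_ball subset_iff)
  qed
  then obtain L where L: "\<And>i j z. i \<le> n \<Longrightarrow> j \<le> n \<Longrightarrow> z \<in> ?I2 \<Longrightarrow> dist (node i j) z < \<epsilon> \<Longrightarrow> h z (L i j) \<noteq> 0"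
    by metis
  have close: "dist (a, b) (a', b') < \<epsilon>"
    if "\<bar>a - a'\<bar> \<le> 1 / real n" "\<bar>b - b'\<bar> \<le> 1 / real n" for a b a' b' :: real
  proof -
    have "dist (a, b) (a', b') \<le> \<bar>a - a'\<bar> + \<bar>b - b'\<bar>"
      using sqrt_sum_squares_le_sum_abs[of "a - a'" "b - b'"] by (simp add: dist_Pair_Pair dist_real_def)
    then show ?thesis using that n(2) by (simp add: field_simps)
  qed
  have self: "h (node i j) (L i j) \<noteq> 0" if "i \<le> n" "j \<le> n" for i j
    using L[OF that node[OF that]] \<epsilon>(1) by simp
  show ?thesis
  proof (rule that[of n L])
    show "0 < n" by (rule n)
    show "L i j \<in> \<V>" if "i \<le> n" "j \<le> n" for i j
    proof -
      have "{V. h (node i j) V \<noteq> 0} \<in> ?K"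
        using hreal[OF node[OF that]] by (simp add: realization_set_def)
      then show ?thesis using self[OF that] by (auto simp: nerve_def)
    qed
    \<comment> \<open>On these three sides the homotopy sits at the vertex \<open>V0\<close>, whose
      only nonzero coordinate is that of \<open>V0\<close>. The side \<open>j = 0\<close> is absent
      because the loop itself runs there.\<close>
    show "L i j = V0" if "i \<le> n" "j \<le> n" "i = 0 \<or> i = n \<or> j = n" for i j
    proof -
      have "h (node i j) = vertex V0"
        using that(3) h0(2)[of "real i / real n"] hside[of "real j / real n"] node[OF that(1,2)] n(1)
        by (auto simp: node_def)
      then show ?thesis using self[OF that(1,2)] by (simp add: vertex_def split: if_splits)
    qed
    \<comment> \<open>Membership is needed on the whole interval around the node and not just at it,
      so that the pieces of \<alpha> can serve as bottom edges of the grid.\<close>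
    show "\<alpha> s \<in> L i 0" if "i \<le> n" "s \<in> {0..1}" "\<bar>s - real i / real n\<bar> \<le> 1 / real n" for i s
    proof -
      have "dist (node i 0) (0, s) < \<epsilon>"
        using that(3) by (auto simp: node_def abs_minus_commute intro!: close)
      then have "p (\<alpha> s) (L i 0) \<noteq> 0"
        using L[of i 0 "(0, s)"] that h0(1)[OF that(2)] by simp
      moreover have "\<alpha> s \<in> topspace X"
        using \<alpha> that(2) path_image_subset_topspace[of X \<alpha>] by (auto simp: loop_at_def)
      ultimately show ?thesis
        using canonical_map_support(3)[OF p] by blast
    qed
    \<comment> \<open>All four labels have nonzero coordinate at the image of the one node
      \<open>node i j\<close>, so they belong to its carrier, a simplex of the nerve; any common
      point of that simplex will do. The guards by \<open>n\<close> admit nodes on the far sides,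
      which have fewer neighbours.\<close>
    show "\<exists>y. \<forall>i'\<in>{i, Suc i}. \<forall>j'\<in>{j, Suc j}. i' \<le> n \<longrightarrow> j' \<le> n \<longrightarrow> y \<in> L i' j'"
      if "i \<le> n" "j \<le> n" for i j
    proof -
      have "{V. h (node i j) V \<noteq> 0} \<in> ?K"
        using hreal[OF node[OF that]] by (simp add: realization_set_def)
      then obtain y where y: "y \<in> \<Inter>{V. h (node i j) V \<noteq> 0}"
        unfolding nerve_def by blast
      have "y \<in> L i' j'" if ij: "i' \<in> {i, Suc i}" "j' \<in> {j, Suc j}" "i' \<le> n" "j' \<le> n" for i' j'
      proof -
        have "dist (node i' j') (node i j) < \<epsilon>"
          unfolding node_def using ij(1,2) by (intro close) (auto simp: diff_divide_distrib[symmetric])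
        then have "h (node i j) (L i' j') \<noteq> 0"
          using L[OF ij(3,4) node[OF \<open>i \<le> n\<close> \<open>j \<le> n\<close>]] by simp
        then show ?thesis using y by blast
      qed
      then show ?thesis by blast
    qed
  qed
qed

text \<open>In the quotient by the Spanier group each square of the grid commutes. As the sides of
  the grid are constant, all rows have the same ordered product; the top row gives the identity and
  the bottom row gives the value of \<alpha>.\<close>

lemma null_homotopic_in_nerve_imp_spanier:
  fixes X :: "'a topology"
  assumes X: "path_connected_space X" and x0: "x0 \<in> topspace X"
    and p: "canonical_map X x0 (\<V>, V0) p" and V0: "x0 \<in> V0"
    and pc: "\<And>V. V \<in> \<V> \<Longrightarrow> path_connectedin X V"
    and star: "\<And>y. y \<in> topspace X \<Longrightarrow> \<exists>U\<in>\<U>. \<forall>V\<in>\<V>. y \<in> V \<longrightarrow> V \<subseteq> U"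
    and \<alpha>: "loop_at X x0 \<alpha>"
    and null: "homotopic_paths_in (nerve_space (\<V>, V0)) (p \<circ> \<alpha>) (\<lambda>_. vertex V0)"
  shows "path_class X \<alpha> \<in> spanier_group X \<U> x0"
proof -
  obtain n L where n: "0 < n" and L: "\<And>i j. i \<le> n \<Longrightarrow> j \<le> n \<Longrightarrow> L i j \<in> \<V>"
    and L0: "\<And>i j. i \<le> n \<Longrightarrow> j \<le> n \<Longrightarrow> i = 0 \<or> i = n \<or> j = n \<Longrightarrow> L i j = V0"
    and L\<alpha>: "\<And>i s. i \<le> n \<Longrightarrow> s \<in> {0..1} \<Longrightarrow> \<bar>s - real i / real n\<bar> \<le> 1 / real n \<Longrightarrow> \<alpha> s \<in> L i 0"
    and common: "\<And>i j. i \<le> n \<Longrightarrow> j \<le> n \<Longrightarrow>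
      \<exists>y. \<forall>i'\<in>{i, Suc i}. \<forall>j'\<in>{j, Suc j}. i' \<le> n \<longrightarrow> j' \<le> n \<longrightarrow> y \<in> L i' j'"
    by (rule null_homotopy_grid_labelling[OF x0 p \<alpha> null]) (rule that)
  obtain Q :: "(real \<Rightarrow> 'a) set set monoid" and c :: "(real \<Rightarrow> 'a) \<Rightarrow> (real \<Rightarrow> 'a) set set"
    where Q: "group Q" and c: "\<And>q. pathin X q \<Longrightarrow> c q \<in> carrier Q"
    and c_join: "\<And>q r. pathin X q \<Longrightarrow> pathin X r \<Longrightarrow> q 1 = r 0 \<Longrightarrow> c (path_join q r) = c q \<otimes>\<^bsub>Q\<^esub> c r"
    and c_hom: "\<And>q r. homotopic_paths_in X q r \<Longrightarrow> c q = c r"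
    and c_loop: "\<And>y \<gamma> U. loop_at X y \<gamma> \<Longrightarrow> U \<in> \<U> \<Longrightarrow> \<gamma> ` {0..1} \<subseteq> U \<Longrightarrow> c \<gamma> = \<one>\<^bsub>Q\<^esub>"
    and c_spanier: "\<And>\<beta>. loop_at X x0 \<beta> \<Longrightarrow> c \<beta> = \<one>\<^bsub>Q\<^esub> \<Longrightarrow> path_class X \<beta> \<in> spanier_group X \<U> x0"
    by (rule spanier_cocycle_exists[OF X x0, of \<U>]) (rule that)
  interpret Q: group Q by (rule Q)
  have \<alpha>': "pathin X \<alpha>" "\<alpha> 0 = x0" "\<alpha> 1 = x0" using \<alpha> by (auto simp: loop_at_def)
  \<comment> \<open>Two paths in one member of \<U> with the same ends form a loop in it when one of
    them is reversed; \<open>c\<close> kills that loop, and the factor of the reversed path is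
    cancelled.\<close>
  have c_eq: "c q = c r" if q: "pathin X q" "q ` {0..1} \<subseteq> U" and r: "pathin X r" "r ` {0..1} \<subseteq> U"
    and ends: "q 0 = r 0" "q 1 = r 1" and U: "U \<in> \<U>" for q r U
  proof -
    have "c s \<otimes>\<^bsub>Q\<^esub> c (path_reverse r) = \<one>\<^bsub>Q\<^esub>"
      if "pathin X s" "s ` {0..1} \<subseteq> U" "s 0 = r 0" "s 1 = r 1" for s
    proof -
      have "loop_at X (r 0) (path_join s (path_reverse r))"
        unfolding loop_at_def using that r by (auto intro!: pathin_join pathin_path_reverse)
      moreover have "path_join s (path_reverse r) ` {0..1} \<subseteq> U"
        using that(2) r(2) by (intro path_join_image) (simp_all add: path_reverse_image)
      ultimately have "c (path_join s (path_reverse r)) = \<one>\<^bsub>Q\<^esub>"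
        using U by (intro c_loop)
      then show ?thesis
        using c_join[of s "path_reverse r"] that r(1) by (simp add: pathin_path_reverse)
    qed
    then have "c q \<otimes>\<^bsub>Q\<^esub> c (path_reverse r) = c r \<otimes>\<^bsub>Q\<^esub> c (path_reverse r)"
      using q r ends by simp
    then show ?thesis
      using c[OF q(1)] c[OF r(1)] c[OF pathin_path_reverse[OF r(1)]] by simp
  qed
  \<comment> \<open>\<open>V0\<close> occurs as a label and contains \<open>x0\<close>, so the
    member of \<U> that \<open>star\<close> assigns to \<open>x0\<close> contains it.\<close>
  have "\<exists>U\<in>\<U>. x0 \<in> U"
    using star[OF x0] L[of 0 0] L0[of 0 0] V0 by auto
  then obtain U0 where U0: "U0 \<in> \<U>" "x0 \<in> U0" by blast
  have c_const: "c (\<lambda>_. x0) = \<one>\<^bsub>Q\<^esub>"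
    using c_loop[of x0 "\<lambda>_. x0" U0] U0 loop_at_const[OF x0] by auto
  \<comment> \<open>Bottom nodes lie on the loop, side and top nodes are \<open>x0\<close>, interior
    nodes are arbitrary points of their labels. At the bottom corners the rules agree because
    \<alpha> is a loop at \<open>x0\<close>.\<close>
  define pt where "pt i j = (if j = 0 then \<alpha> (real i / real n)
    else if i = 0 \<or> i = n \<or> j = n then x0 else SOME y. y \<in> L i j)" for i j
  have pt0: "pt i j = x0" if "i = 0 \<or> i = n \<or> j = n" for i j
    using that \<alpha>' n by (auto simp: pt_def)
  have pt: "pt i j \<in> L i j" if ij: "i \<le> n" "j \<le> n" for i j
  proof -
    consider "j = 0" | "i = 0 \<or> i = n \<or> j = n" | "j \<noteq> 0" "\<not> (i = 0 \<or> i = n \<or> j = n)" by blast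
    then show ?thesis
    proof cases
      case 1
      then show ?thesis using L\<alpha>[of i "real i / real n"] ij n by (simp add: pt_def)
    next
      case 2
      then show ?thesis using pt0 L0[OF ij] V0 by simp
    next
      case 3
      have "L i j \<noteq> {}" using common[OF ij] ij by auto
      then show ?thesis using 3 by (simp add: pt_def some_in_eq)
    qed
  qed
  \<comment> \<open>The common point \<open>z\<close> makes the union of the two path connected
    labels path connected.\<close>
  have connect: "\<exists>q. pathin X q \<and> q 0 = x \<and> q 1 = y \<and> q ` {0..1} \<subseteq> V \<union> W"
    if VW: "V \<in> \<V>" "W \<in> \<V>" "x \<in> V" "y \<in> W" "z \<in> V" "z \<in> W" for V W x y z
  proof -
    have "path_connectedin X (V \<union> W)"
      using VW pc by (intro path_connectedin_Un) auto
    then have "path_connected_space (subtopology X (V \<union> W))" "V \<union> W \<subseteq> topspace X"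
      by (auto simp: path_connectedin_def)
    moreover from this have "x \<in> topspace (subtopology X (V \<union> W))" "y \<in> topspace (subtopology X (V \<union> W))"
      using VW by auto
    ultimately obtain q where "pathin (subtopology X (V \<union> W)) q" "q 0 = x" "q 1 = y"
      unfolding path_connected_space_def by meson
    then show ?thesis
      by (intro exI[of _ q]) (auto simp: pathin_subtopology image_subset_iff Pi_iff)
  qed
  \<comment> \<open>Boundary edges are prescribed: bottom edges are pieces of \<alpha>, so that
    their product recovers it, and top edges are constant, so that they drop out. Since
    \<open>0 < n\<close>, the two requirements never meet.\<close>
  define hor where "hor i j q \<longleftrightarrow> pathin X q \<and> q 0 = pt i j \<and> q 1 = pt (Suc i) j \<and>
      q ` {0..1} \<subseteq> L i j \<union> L (Suc i) j \<and>
      (j = 0 \<longrightarrow> q = subpath_in \<alpha> (real i / real n) (real (Suc i) / real n)) \<and> (j = n \<longrightarrow> q = (\<lambda>_. x0))"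
    for i j q
  have "\<exists>q. hor i j q"
    if ij: "i < n" "j \<le> n" for i j
  proof -
    consider "j = 0" | "j = n" | "j \<noteq> 0" "j \<noteq> n" by blast
    then show ?thesis
    proof cases
      case 1
      have le: "0 \<le> real i / real n" "real i / real n \<le> real (Suc i) / real n" "real (Suc i) / real n \<le> 1"
        using ij n by (simp_all add: divide_right_mono)
      have "\<alpha> ` {real i / real n..real (Suc i) / real n} \<subseteq> L i 0"
      proof (rule image_subsetI)
        fix s assume s: "s \<in> {real i / real n..real (Suc i) / real n}"
        show "\<alpha> s \<in> L i 0"
          using ij(1) grid_interval[OF ij(1) s] by (intro L\<alpha>) auto
      qed
      then have "subpath_in \<alpha> (real i / real n) (real (Suc i) / real n) ` {0..1} \<subseteq> L i 0"
        using subpath_in_image[OF le(2), of \<alpha>] by (rule order_trans[rotated])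
      then show ?thesis
        unfolding hor_def using 1 n pathin_subpath_in[OF \<alpha>'(1) le]
        by (intro exI[of _ "subpath_in \<alpha> (real i / real n) (real (Suc i) / real n)"]) (auto simp: pt_def)
    next
      case 2
      then show ?thesis
        unfolding hor_def using pt0 L0[of i j] V0 ij n x0 by (intro exI[of _ "\<lambda>_. x0"]) (auto simp: pathin_const)
    next
      case 3
      obtain z where "z \<in> L i j" "z \<in> L (Suc i) j"
        using common[of i j] ij by auto
      then show ?thesis
        unfolding hor_def using connect[of "L i j" "L (Suc i) j" "pt i j" "pt (Suc i) j" z] 3 L pt ij by auto
    qed
  qed
  then obtain H where "\<And>i j. i < n \<Longrightarrow> j \<le> n \<Longrightarrow> hor i j (H i j)"
    by metis
  note hor = this[unfolded hor_def]
  have H: "pathin X (H i j)" "H i j 0 = pt i j" "H i j 1 = pt (Suc i) j" "H i j ` {0..1} \<subseteq> L i j \<union> L (Suc i) j"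
    if "i < n" "j \<le> n" for i j
    using hor[OF that] by simp_all
  have Hbottom: "H i 0 = subpath_in \<alpha> (real i / real n) (real (Suc i) / real n)" if "i < n" for i
    using hor[OF that, of 0] by simp
  have Htop: "H i n = (\<lambda>_. x0)" if "i < n" for i
    using hor[OF that order_refl] by simp
  define ver where "ver i j q \<longleftrightarrow> pathin X q \<and> q 0 = pt i j \<and> q 1 = pt i (Suc j) \<and>
      q ` {0..1} \<subseteq> L i j \<union> L i (Suc j) \<and> (i = 0 \<or> i = n \<longrightarrow> q = (\<lambda>_. x0))"
    for i j q
  have "\<exists>q. ver i j q"
    if ij: "i \<le> n" "j < n" for i j
  proof (cases "i = 0 \<or> i = n")
    case True
    then show ?thesis
      unfolding ver_def using pt0 L0[of i j] V0 ij x0 by (intro exI[of _ "\<lambda>_. x0"]) (auto simp: pathin_const)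
  next
    case False
    obtain z where "z \<in> L i j" "z \<in> L i (Suc j)"
      using common[of i j] ij by auto
    then show ?thesis
      unfolding ver_def using connect[of "L i j" "L i (Suc j)" "pt i j" "pt i (Suc j)" z] False L pt ij by auto
  qed
  then obtain V where "\<And>i j. i \<le> n \<Longrightarrow> j < n \<Longrightarrow> ver i j (V i j)"
    by metis
  note ver = this[unfolded ver_def]
  have V: "pathin X (V i j)" "V i j 0 = pt i j" "V i j 1 = pt i (Suc j)" "V i j ` {0..1} \<subseteq> L i j \<union> L i (Suc j)"
    if "i \<le> n" "j < n" for i j
    using ver[OF that] by simp_all
  have Vside: "V 0 j = (\<lambda>_. x0)" "V n j = (\<lambda>_. x0)" if "j < n" for j
    using ver[of 0 j] ver[of n j] that by simp_all
  \<comment> \<open>The four labels share a point, so one member of \<U> contains them all, and both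
    routes around the square run inside it between the same corners.\<close>
  have square: "c (H i j) \<otimes>\<^bsub>Q\<^esub> c (V (Suc i) j) = c (V i j) \<otimes>\<^bsub>Q\<^esub> c (H i (Suc j))"
    if ij: "i < n" "j < n" for i j
  proof -
    have le: "i \<le> n" "Suc i \<le> n" "j \<le> n" "Suc j \<le> n" using ij by auto
    obtain y where y: "y \<in> L i j" "y \<in> L (Suc i) j" "y \<in> L i (Suc j)" "y \<in> L (Suc i) (Suc j)"
      using common[OF le(1,3)] le by auto
    have "y \<in> topspace X"
      using y(1) path_connectedin_subset_topspace[OF pc[OF L[OF le(1,3)]]] by blast
    from star[OF this] obtain U where U: "U \<in> \<U>" "\<And>V. V \<in> \<V> \<Longrightarrow> y \<in> V \<Longrightarrow> V \<subseteq> U"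
      by auto
    have sub: "L i j \<subseteq> U" "L (Suc i) j \<subseteq> U" "L i (Suc j) \<subseteq> U" "L (Suc i) (Suc j) \<subseteq> U"
      using U(2) L le y by simp_all
    note paths = H(1)[OF ij(1) le(3)] V(1)[OF le(2) ij(2)] V(1)[OF le(1) ij(2)] H(1)[OF ij(1) le(4)]
    note ends = H(2,3)[OF ij(1) le(3)] V(2,3)[OF le(2) ij(2)] V(2,3)[OF le(1) ij(2)] H(2,3)[OF ij(1) le(4)]
    have ims: "H i j ` {0..1} \<subseteq> U" "V (Suc i) j ` {0..1} \<subseteq> U" "V i j ` {0..1} \<subseteq> U" "H i (Suc j) ` {0..1} \<subseteq> U"
      using H(4)[OF ij(1) le(3)] V(4)[OF le(2) ij(2)] V(4)[OF le(1) ij(2)] H(4)[OF ij(1) le(4)] sub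
      by (meson Un_least order_trans)+
    have "c (path_join (H i j) (V (Suc i) j)) = c (path_join (V i j) (H i (Suc j)))"
      using paths ims U(1) by (intro c_eq[of _ U] path_join_image pathin_join) (simp_all add: ends)
    then show ?thesis
      using paths by (simp add: c_join ends)
  qed
  \<comment> \<open>Pasting the squares relates consecutive rows through their outer vertical edges,
    which are constant paths at \<open>x0\<close> and hence have trivial value.\<close>
  define row where "row j = partial_prod Q (\<lambda>i. c (H i j)) n" for j
  have "row (Suc j) = row j" if "j < n" for j
  proof -
    have "row j \<otimes>\<^bsub>Q\<^esub> c (V n j) = c (V 0 j) \<otimes>\<^bsub>Q\<^esub> row (Suc j)"
      unfolding row_def using that square
      by (intro Q.partial_prod_commuting_squares c H V) auto
    moreover have "row j \<in> carrier Q" "row (Suc j) \<in> carrier Q"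
      unfolding row_def using that by (auto intro!: Q.partial_prod_closed c H)
    ultimately show ?thesis
      using Vside[OF that] c_const by simp
  qed
  then have "j \<le> n \<Longrightarrow> row j = row 0" for j
    by (induction j) auto
  from this[OF order_refl] have "row n = row 0" .
  moreover have "row n = \<one>\<^bsub>Q\<^esub>"
    unfolding row_def using Htop c_const by (intro Q.partial_prod_one) simp
  ultimately have row0: "row 0 = \<one>\<^bsub>Q\<^esub>" by simp
  \<comment> \<open>The bottom edges reassemble \<alpha>; the empty product matches the constant
    subpath at \<open>k = 0\<close>.\<close>
  have "k \<le> n \<Longrightarrow> partial_prod Q (\<lambda>i. c (H i 0)) k = c (subpath_in \<alpha> 0 (real k / real n))" for k
  proof (induction k)
    case 0
    then show ?case using \<alpha>' c_const by (simp add: subpath_in_def)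
  next
    case (Suc k)
    have le: "real k / real n \<le> real (Suc k) / real n" "real (Suc k) / real n \<le> 1" "0 \<le> real k / real n"
      using Suc.prems n by (simp_all add: divide_right_mono)
    then have le': "real k / real n \<le> 1" by linarith
    have "partial_prod Q (\<lambda>i. c (H i 0)) (Suc k) =
        c (subpath_in \<alpha> 0 (real k / real n)) \<otimes>\<^bsub>Q\<^esub> c (subpath_in \<alpha> (real k / real n) (real (Suc k) / real n))"
      using Suc Hbottom[of k] by simp
    also have "\<dots> = c (path_join (subpath_in \<alpha> 0 (real k / real n)) (subpath_in \<alpha> (real k / real n) (real (Suc k) / real n)))"
      by (rule c_join[symmetric, OF pathin_subpath_in pathin_subpath_in]) (simp_all only: \<alpha>' le le' order_refl subpath_in_ends)
    also have "\<dots> = c (subpath_in \<alpha> 0 (real (Suc k) / real n))"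
      by (rule c_hom[OF homotopic_join_subpaths_in]) (simp_all only: \<alpha>' le order_refl)
    finally show ?case .
  qed
  from this[of n] have "c (subpath_in \<alpha> 0 1) = \<one>\<^bsub>Q\<^esub>"
    using row0 n by (simp add: row_def)
  moreover have "subpath_in \<alpha> 0 1 = \<alpha>" by (simp add: subpath_in_def)
  ultimately show ?thesis using c_spanier[OF \<alpha>] by simp
qed

text \<open>A single coordinate \<open>v\<close> of the product suffices, and a condition on one
  coordinate is open because the factors are discrete.\<close>

lemma spanier_group_contains_kernel:
  assumes X: "path_connected_space X" "locally_path_connected_space X" "paracompact_space X" "Hausdorff_space X"
    and x0: "x0 \<in> topspace X" and \<U>: "open_cover X \<U>"
  obtains v where "v \<in> shape_index X x0"
    "\<And>A. A \<in> carrier (fundamental_group X x0) \<Longrightarrow> shape_map X x0 A v = \<one>\<^bsub>nerve_group v\<^esub> \<Longrightarrow> A \<in> spanier_group X \<U> x0"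
proof -
  obtain \<V> V0 where v: "(\<V>, V0) \<in> shape_index X x0" and pc: "\<And>V. V \<in> \<V> \<Longrightarrow> path_connectedin X V"
    and star: "\<And>y. y \<in> topspace X \<Longrightarrow> \<exists>U\<in>\<U>. \<forall>V\<in>\<V>. y \<in> V \<longrightarrow> V \<subseteq> U"
    using path_connected_point_star_refinement[OF X(3,4,2) \<U> x0] by metis
  have V0: "x0 \<in> V0" using v by (auto simp: shape_index_def)
  obtain p where p: "canonical_map X x0 (\<V>, V0) p"
    "\<And>\<alpha>. loop_at X x0 \<alpha> \<Longrightarrow> shape_map X x0 (path_class X \<alpha>) (\<V>, V0) = path_class (nerve_space (\<V>, V0)) (p \<circ> \<alpha>)"
    using shape_map_apply[OF v] by metis
  have "A \<in> spanier_group X \<U> x0"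
    if A: "A \<in> carrier (fundamental_group X x0)" "shape_map X x0 A (\<V>, V0) = \<one>\<^bsub>nerve_group (\<V>, V0)\<^esub>" for A
  proof -
    obtain \<alpha> where \<alpha>: "loop_at X x0 \<alpha>" "A = path_class X \<alpha>"
      using A(1) unfolding fundamental_group_carrier by blast
    have "pathin (nerve_space (\<V>, V0)) (p \<circ> \<alpha>)"
      using p(1) \<alpha>(1) by (auto simp: canonical_map_def loop_at_def intro: pathin_compose)
    moreover have "path_class (nerve_space (\<V>, V0)) (p \<circ> \<alpha>) = path_class (nerve_space (\<V>, V0)) (\<lambda>_. vertex V0)"
      using A(2) p(2)[OF \<alpha>(1)] \<alpha>(2) by (simp add: nerve_group_def fundamental_group_one)
    ultimately have "homotopic_paths_in (nerve_space (\<V>, V0)) (p \<circ> \<alpha>) (\<lambda>_. vertex V0)"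
      by (simp only: path_class_eq)
    then show ?thesis
      unfolding \<alpha>(2) using null_homotopic_in_nerve_imp_spanier[OF X(1) x0 p(1) V0 pc star \<alpha>(1)] by blast
  qed
  with v show ?thesis by (rule that)
qed

text \<open>A basic open set of the product restricts only finitely many coordinates. For these,
  finite intersections of pulled back open stars are still open, and a Spanier group adapted to them
  is invisible in each of those coordinates.\<close>

lemma open_contains_spanier_group:
  assumes x0: "x0 \<in> topspace X" and W: "openin (shape_topology X x0) W" "\<one>\<^bsub>fundamental_group X x0\<^esub> \<in> W"
  obtains \<W> where "open_cover X \<W>" "spanier_group X \<W> x0 \<subseteq> W"
proof -
  let ?I = "shape_index X x0" and ?G = "fundamental_group X x0"
  interpret G: group ?G using x0 by (rule group_fundamental_group)
  obtain T where T: "openin (product_topology (\<lambda>u. discrete_topology (carrier (nerve_group u))) ?I) T"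
    and WT: "W = {A \<in> carrier ?G. shape_map X x0 A \<in> T}"
    using W(1) unfolding openin_shape_topology by blast
  have "shape_map X x0 \<one>\<^bsub>?G\<^esub> \<in> T" using W(2) WT by simp
  then obtain B where B: "finite {u \<in> ?I. B u \<noteq> carrier (nerve_group u)}"
    "shape_map X x0 \<one>\<^bsub>?G\<^esub> \<in> Pi\<^sub>E ?I B" "Pi\<^sub>E ?I B \<subseteq> T"
    using T unfolding openin_product_topology_alt topspace_discrete_topology by meson
  define F where "F = {u \<in> ?I. B u \<noteq> carrier (nerve_group u)}"
  have "\<forall>u\<in>?I. \<exists>p. canonical_map X x0 u p \<and> (\<forall>A. shape_map X x0 A u = induced_map (nerve_space u) p A)"
    using shape_map_apply by metis
  then obtain p where p: "\<And>u. u \<in> ?I \<Longrightarrow> canonical_map X x0 u (p u)"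
    "\<And>u A. u \<in> ?I \<Longrightarrow> shape_map X x0 A u = induced_map (nerve_space u) (p u) A"
    by metis
  \<comment> \<open>For each restricted coordinate the whole set must go into the open star of one
    vertex, which may depend on the coordinate.\<close>
  define \<W> where "\<W> = {W. openin X W \<and> (\<forall>u\<in>F. \<exists>U\<in>fst u. \<forall>x\<in>W. p u x U \<noteq> 0)}"
  have "x \<in> \<Union>\<W>" if x: "x \<in> topspace X" for x
  proof -
    have "\<exists>U\<in>fst u. p u x U \<noteq> 0" if "u \<in> F" for u
    proof -
      have "canonical_map X x0 u (p u)" using that p(1) by (simp add: F_def)
      from canonical_map_support(2)[OF this x] show ?thesis by (auto simp: nerve_def)
    qed
    then obtain U where U: "\<And>u. u \<in> F \<Longrightarrow> U u \<in> fst u" "\<And>u. u \<in> F \<Longrightarrow> p u x (U u) \<noteq> 0"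
      by metis
    define B' where "B' u = {y \<in> topspace X. p u y \<in> open_star (nerve (fst u)) (U u)}" for u
    have cont: "continuous_map X (realization (nerve (fst u))) (p u)" if "u \<in> F" for u
      using that p(1) by (simp add: F_def canonical_map_def nerve_space_def)
    have "openin X (B' u)" if "u \<in> F" for u
      unfolding B'_def by (rule openin_continuous_map_preimage[OF cont[OF that] openin_open_star])
    moreover have "finite F" using B(1) by (simp add: F_def)
    \<comment> \<open>Intersecting with the whole space gives the right set also when no coordinate
      is restricted.\<close>
    ultimately have "openin X (topspace X \<inter> (\<Inter>u\<in>F. B' u))"
      using openin_INT[of F X B'] by (simp add: Int_commute)
    moreover have "x \<in> B' u" if "u \<in> F" for u
      using x U(2)[OF that] cont[OF that] by (auto simp: B'_def open_star_def continuous_map_def)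
    moreover have "\<exists>V\<in>fst u. \<forall>y\<in>topspace X \<inter> (\<Inter>u\<in>F. B' u). p u y V \<noteq> 0" if "u \<in> F" for u
      using that U(1)[OF that] by (intro bexI[of _ "U u"]) (auto simp: B'_def open_star_def)
    ultimately have "topspace X \<inter> (\<Inter>u\<in>F. B' u) \<in> \<W>" "x \<in> topspace X \<inter> (\<Inter>u\<in>F. B' u)"
      unfolding \<W>_def using x by (simp, blast)
    then show ?thesis by (rule UnionI)
  qed
  moreover have "\<Union>\<W> \<subseteq> topspace X"
    unfolding \<W>_def using openin_subset by blast
  ultimately have "open_cover X \<W>"
    unfolding open_cover_def \<W>_def by blast
  moreover have "spanier_group X \<W> x0 \<subseteq> W"
  proof
    fix A assume A: "A \<in> spanier_group X \<W> x0"
    then have carr: "A \<in> carrier ?G"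
      using G.generate_in_carrier[OF spanier_generators_carrier] by (simp add: spanier_group_eq_generate)
    have ker: "shape_map X x0 C u = \<one>\<^bsub>nerve_group u\<^esub>" if "u \<in> F" "C \<in> spanier_group X \<W> x0" for u C
    proof -
      have u: "u \<in> ?I" using that(1) by (simp add: F_def)
      show ?thesis
        unfolding p(2)[OF u]
        by (rule spanier_group_in_kernel[OF x0 p(1)[OF u] _ that(2)]) (use that(1) in \<open>auto simp: \<W>_def\<close>)
    qed
    have one: "\<one>\<^bsub>?G\<^esub> \<in> spanier_group X \<W> x0"
      by (simp add: spanier_group_eq_generate generate.one)
    have "shape_map X x0 A \<in> Pi\<^sub>E ?I B"
    proof
      fix u assume u: "u \<in> ?I"
      show "shape_map X x0 A u \<in> B u"
      proof (cases "u \<in> F")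
        case True
        \<comment> \<open>At a restricted coordinate \<open>A\<close> and the identity have the same
          value, and the value of the identity is known to lie in \<open>B u\<close>.\<close>
        then show ?thesis using ker[OF True A] ker[OF True one] PiE_mem[OF B(2) u] by simp
      next
        case False
        then have "B u = carrier (nerve_group u)" using u by (simp add: F_def)
        then show ?thesis
          using shape_map_in_carrier[OF carr] u by (auto simp: shape_group_def)
      qed
    qed (simp add: shape_map_def)
    then show "A \<in> W" using B(3) carr WT by blast
  qed
  ultimately show ?thesis by (rule that)
qed

theorem corollary45:
  fixes X :: "'a topology" and x0 :: 'a
  assumes "path_connected_space X"
    and "locally_path_connected_space X"
    and "paracompact_space X"
    and "Hausdorff_space X"
    and "x0 \<in> topspace X"
  shows "is_nhd_base_at (shape_topology X x0) \<one>\<^bsub>fundamental_group X x0\<^esub>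
           {spanier_group X \<U> x0 | \<U>. open_cover X \<U>}"
  unfolding is_nhd_base_at_def
proof (intro conjI ballI allI impI)
  let ?G = "fundamental_group X x0"
  interpret G: group ?G using assms(5) by (rule group_fundamental_group)
  fix N assume "N \<in> {spanier_group X \<U> x0 | \<U>. open_cover X \<U>}"
  then obtain \<U> where \<U>: "open_cover X \<U>" and N: "N = spanier_group X \<U> x0" by blast
  show "N \<subseteq> topspace (shape_topology X x0)"
    unfolding N topspace_shape_topology spanier_group_eq_generate
    by (rule G.generate_incl[OF spanier_generators_carrier])
  obtain v where v: "v \<in> shape_index X x0"
    "\<And>A. A \<in> carrier ?G \<Longrightarrow> shape_map X x0 A v = \<one>\<^bsub>nerve_group v\<^esub> \<Longrightarrow> A \<in> N"
    using spanier_group_contains_kernel[OF assms \<U>] N by metis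
  let ?P = "product_topology (\<lambda>u. discrete_topology (carrier (nerve_group u))) (shape_index X x0)"
  \<comment> \<open>The slice of the product with trivial coordinate at \<open>v\<close>.
    Intersecting with the carrier makes the singleton visibly open in the discrete factor.\<close>
  define T where "T = {g \<in> topspace ?P. g v \<in> {\<one>\<^bsub>nerve_group v\<^esub>} \<inter> carrier (nerve_group v)}"
  have "openin ?P T"
    unfolding T_def by (rule openin_continuous_map_preimage[OF continuous_map_product_projection[OF v(1)]]) simp
  then have "openin (shape_topology X x0) {A \<in> carrier ?G. shape_map X x0 A \<in> T}"
    unfolding openin_shape_topology by blast
  moreover have "\<one>\<^bsub>?G\<^esub> \<in> {A \<in> carrier ?G. shape_map X x0 A \<in> T}"
  proof -
    have in_P: "shape_map X x0 \<one>\<^bsub>?G\<^esub> \<in> topspace ?P"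
      using shape_map_in_carrier[OF G.one_closed] by (auto simp: shape_group_def)
    obtain p where p: "canonical_map X x0 v p"
      "\<And>\<alpha>. loop_at X x0 \<alpha> \<Longrightarrow> shape_map X x0 (path_class X \<alpha>) v = path_class (nerve_space v) (p \<circ> \<alpha>)"
      using shape_map_apply[OF v(1)] by metis
    have "shape_map X x0 \<one>\<^bsub>?G\<^esub> v = \<one>\<^bsub>nerve_group v\<^esub>"
      using p(2)[OF loop_at_const[OF assms(5)]] p(1)
      by (simp add: fundamental_group_one nerve_group_def o_def canonical_map_def)
    moreover have "shape_map X x0 \<one>\<^bsub>?G\<^esub> v \<in> carrier (nerve_group v)"
      using in_P v(1) by auto
    ultimately show ?thesis using in_P by (simp add: T_def)
  qed
  moreover have "{A \<in> carrier ?G. shape_map X x0 A \<in> T} \<subseteq> N"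
    using v(2) by (auto simp: T_def)
  ultimately show "\<exists>U. openin (shape_topology X x0) U \<and> \<one>\<^bsub>?G\<^esub> \<in> U \<and> U \<subseteq> N" by blast
next
  fix W assume W: "openin (shape_topology X x0) W \<and> \<one>\<^bsub>fundamental_group X x0\<^esub> \<in> W"
  then obtain \<W> where "open_cover X \<W>" "spanier_group X \<W> x0 \<subseteq> W"
    using open_contains_spanier_group[OF assms(5)] by metis
  then show "\<exists>N\<in>{spanier_group X \<U> x0 | \<U>. open_cover X \<U>}. N \<subseteq> W" by blast
qed

end
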